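(* Let $A\in\mathbb{C}^{n\times n}$, $u,v\in\mathbb{C}^n$, let $l\in\mathbb{N}$ denote the degree of the minimal polynomial $m_A(\lambda)$ of $A$, and let $B(\tau)=A+\tau uv^*$. Assume also that $$v^*u=\cdots=v^*A^{\kappa-1}u=0,\quad v^*A^\kappa u\neq0$$ for some $\kappa\in\{0,\dots,l-1\}$, and put $v^*A^\kappa u=r_\kappa e^{i\theta_\kappa}$. Then: (i) $p_{uv}(\lambda)$ is of degree $l-\kappa-1$; (ii) $l-\kappa-1$ eigenvalues of $B(\tau)$ converge to the roots of $p_{uv}(\lambda)$ as $\tau\to\infty$; (iii) there are $\kappa+1$ eigenvalues $\lambda_1(\tau),\dots,\lambda_{\kappa+1}(\tau)$ of $A+\tau uv^*$ which go to infinity with $r=|\tau|\to\infty$ as $$\lambda_j(re^{i\theta})=\sqrt[\kappa+1]{r\,r_\kappa}\;e^{i\left(\frac{1}{\kappa+1}(\theta+\theta_\kappa)+\frac{2j}{\kappa+1}\pi\right)}+O(1),\qquad j=1,2,\dots,\kappa+1,$$ where $\theta\in[0,2\pi)$ is fixed, and for all of them we have $$\frac{d\lambda_j}{d\tau}=\frac{v^*A^\kappa u}{l\lambda_j^\kappa}+O\left(\lambda_j^{-(\kappa+1)}\right),$$ so these eigenvalues can be parametrized by a curve $$\Gamma(\theta)=(r\,r_\kappa)^{\frac{1}{\kappa+1}}\exp(i\theta)+O(1),\quad (r\to\infty);$$ (iv) as $\theta\to2\pi$ one has, after possibly renumbering the eigenvalues $\lambda_1(\tau),\dots,\lambda_{\kappa+1}(\tau)$,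 that $$\lambda_j(re^{i\theta})\to\lambda_{j+1}(r),\quad j=1,\dots,\kappa,\qquad \lambda_{\kappa+1}(re^{i\theta})\to\lambda_1(r);$$ (v) additionally, let $\zeta_1,\dots,\zeta_\nu$ denote the roots of the polynomial $p_{uv}(\lambda)$ with multiplicities respectively $k_1,\dots,k_\nu$. Denote $$v^*(\zeta_jI_n-A)^{-(k_j+1)}u=\rho_je^{i\theta_j},\qquad j=1,\dots,\nu.$$ Then $\sigma(A,u,v;t)$ for sufficiently large $\tau$ can be parametrized by disjoint curves $\Gamma_1(\theta),\dots,\Gamma_{\nu+1}(\theta)$, where the $\kappa+1$ eigenvalues which go to infinity trace out a curve $$\Gamma_{\nu+1}(\theta)=(r\,r_\kappa)^{\frac{1}{\kappa+1}}\exp(i\theta)+O(1),$$ while the $k_j$ eigenvalues near $\zeta_j$ trace out a curve $\Gamma_j(\theta)$ which is of the form $$\Gamma_j(\theta)=\zeta_j+|\tau|^{-\frac{1}{k_j}}\rho_j^{-\frac{1}{k_j}}e^{i\theta}+O\left(|\tau|^{-\frac{2}{k_j}}\right),\qquad 0\le\theta\le2\pi,$$ with $r=|\tau|\to\infty$.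
   Context: $X^*=\bar X^\top$ denotes the conjugate transpose. $m_A(\lambda)$ is the minimal polynomial of $A$, and $p_{uv}(\lambda)=v^*m_A(\lambda)(\lambda I_n-A)^{-1}u$, which is a polynomial. The numbers $r_\kappa,\theta_\kappa$ and $\rho_j,\theta_j$ are the moduli and arguments in the polar forms of the indicated complex numbers. The complex parameter is written $\tau=te^{i\theta}$, so that $t=r=|\tau|$. For $t>0$, $$\sigma(A,u,v;t)=\bigcup_{0\le\theta<2\pi}\sigma(A+te^{i\theta}uv^* ),$$ where $\sigma(\cdot)$ denotes the spectrum of a matrix.
   Formalization: In (iii) the denominator of the derivative is (κ+1)λ_j^κ instead of lλ_j^κ; in (v) the roots ζ_j are assumed not to be eigenvalues of A, and σ(A,u,v;t) is the union of the curves and the constant eigenvalues, i.e. the roots of the characteristic polynomial of A divided by m_A. *)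

theory Defs
  imports
    "HOL-Analysis.Complex_Transcendental"
    "HOL-Library.Landau_Symbols"
    "Jordan_Normal_Form.Spectral_Radius"
begin

text \<open>Throughout, \<open>v\<^sup>* x\<close> is written \<open>x \<bullet>c v\<close>, which conjugates its second argument.\<close>

definition outer :: "complex vec \<Rightarrow> complex vec \<Rightarrow> complex mat" where
  "outer u v = mat (dim_vec u) (dim_vec v) (\<lambda>(i, j). vec_index u i * cnj (vec_index v j))"

definition perturb :: "complex mat \<Rightarrow> complex vec \<Rightarrow> complex vec \<Rightarrow> complex \<Rightarrow> complex mat" where
  "perturb A u v \<tau> = A + \<tau> \<cdot>\<^sub>m outer u v"

text \<open>The zero-th power of \<open>A\<close> is the identity, so the constant term of \<open>p\<close> is handled correctly.\<close>

definition mat_poly :: "complex poly \<Rightarrow> complex mat \<Rightarrow> complex mat" where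
  "mat_poly p A = mat (dim_row A) (dim_col A)
     (\<lambda>(i, j). \<Sum>k\<le>degree p. coeff p k * (A ^\<^sub>m k) $$ (i, j))"

definition annihilates :: "complex poly \<Rightarrow> complex mat \<Rightarrow> bool" where
  "annihilates p A \<longleftrightarrow> mat_poly p A = 0\<^sub>m (dim_row A) (dim_col A)"

definition min_poly :: "complex mat \<Rightarrow> complex poly" where
  "min_poly A = (THE p. lead_coeff p = 1 \<and> annihilates p A \<and>
     (\<forall>q. q \<noteq> 0 \<and> annihilates q A \<longrightarrow> degree p \<le> degree q))"

text \<open>The inverse of \<open>z I - A\<close>; only meaningful for \<open>z\<close> outside the spectrum of \<open>A\<close>.\<close>

definition resolvent :: "complex mat \<Rightarrow> complex \<Rightarrow> complex mat" where
  "resolvent A z = the (mat_inverse (z \<cdot>\<^sub>m 1\<^sub>m (dim_row A) - A))"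

text \<open>The polynomial \<open>m\<^sub>A(z) v\<^sup>* (z I - A)\<^sup>-\<^sup>1 u\<close>. The defining equation is required off the (finite)
  spectrum only, where the inverse exists; this determines the polynomial.\<close>

definition p_uv :: "complex mat \<Rightarrow> complex vec \<Rightarrow> complex vec \<Rightarrow> complex poly" where
  "p_uv A u v = (THE p. \<forall>z. z \<notin> spectrum A \<longrightarrow>
     poly p z = poly (min_poly A) z * ((resolvent A z *\<^sub>v u) \<bullet>c v))"

definition circle_spectrum :: "complex mat \<Rightarrow> complex vec \<Rightarrow> complex vec \<Rightarrow> real \<Rightarrow> complex set" where
  "circle_spectrum A u v t =
     (\<Union>\<theta>\<in>{0..<2 * pi}. spectrum (perturb A u v (of_real t * cis \<theta>)))"

text \<open>The roots of the characteristic polynomial of \<open>A\<close> divided by the minimal polynomial. They are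
  eigenvalues of every rank-one perturbation of \<open>A\<close> and do not depend on the parameter. The set is
  empty iff the minimal and the characteristic polynomial of \<open>A\<close> coincide.\<close>

definition frozen_eigenvalues :: "complex mat \<Rightarrow> complex set" where
  "frozen_eigenvalues A = {z. poly (char_poly A div min_poly A) z = 0}"

definition closed_curve :: "(real \<Rightarrow> complex) \<Rightarrow> bool" where
  "closed_curve g \<longleftrightarrow> continuous_on {0..2 * pi} g \<and> g 0 = g (2 * pi)"

definition trace_of :: "(real \<Rightarrow> complex) \<Rightarrow> complex set" where
  "trace_of g = g ` {0..2 * pi}"

text \<open>The plane is cut along the nonnegative real axis, whose points belong to the upper side of the
  cut (argument \<open>0\<close>). The set below is a neighbourhood of every \<open>\<tau>\<close> off that axis, so
  differentiability within it is plain complex differentiability there; for positive real \<open>\<tau>\<close> it is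
  an upper half plane including the positive axis, so the derivative is then one-sided.\<close>

definition slit_nbhd :: "complex \<Rightarrow> complex set" where
  "slit_nbhd \<tau> = {s. \<bar>Arg2pi s - Arg2pi \<tau>\<bar> < pi}"

end

theory Submission
  imports Defs "HOL-Complex_Analysis.Complex_Analysis"
begin

text \<open>By the matrix determinant lemma \<open>\<chi>\<close> of \<open>A + \<tau> u v\<^sup>*\<close> is \<open>(\<chi>\<^sub>A / m\<^sub>A) (m\<^sub>A - \<tau> p\<^sub>u\<^sub>v)\<close>, so the moving
  eigenvalues solve \<open>p\<^sub>u\<^sub>v(\<lambda>) / m\<^sub>A(\<lambda>) = 1 / \<tau>\<close>. Near a zero \<open>\<zeta>\<close> of order \<open>k\<close> of the left-hand side, and near
  infinity after the substitution \<open>\<lambda> = 1 / x\<close>, this reads \<open>x\<^sup>k H(x) = 1 / \<tau>\<close> with \<open>H(0) \<noteq> 0\<close>. Its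
  solutions are \<open>x = \<psi>(s)\<close>, where \<open>\<psi>\<close> is one univalent holomorphic function and \<open>s\<close> runs through the
  \<open>k\<close>-th roots of \<open>1 / \<tau>\<close>. All asymptotics are Taylor estimates of \<open>\<psi>\<close>, the traced curves are images
  of circles under \<open>\<psi>\<close>, and turning \<open>\<tau>\<close> once around the origin permutes the roots \<open>s\<close>
  cyclically. Counting degrees shows that these are all the roots.\<close>

subsection \<open>The minimal polynomial and the resolvent\<close>

text \<open>The obstacle is that \<open>min_poly A\<close> and \<open>p_uv A u v\<close> may have
  common zeros, where their quotient need not vanish to the expected order. A monic common factor is
  split off: its zeros stay eigenvalues for every parameter and give the constant members of the
  bounded family, while the coprime rest obeys the branch analysis. Zeros of
  \<open>min_poly A\<close> lie in the spectrum, so when all zeros of \<open>p_uv A u v\<close> lie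
  off it, the case in which \<open>resolvent\<close> is evaluated at them, this factor is 1.
  Uniformity is automatic: one \<open>\<phi>\<close> serves all determinations of the root, and its
  bounds hold on a full disc in s, so no constant depends on arg tau. Since |s| = |tau|^(-1/k), an
  error of order s^2 gives |tau|^(-2/k), and a relative error of order s on an eigenvalue of size
  1/|s| gives O(1). The parameter of the traced curves is not arg tau. While tau runs once round its
  circle, each determination of s covers only 1/k of a circle; the k arcs together fill it, and the
  circle is then reparametrised by angle so that the leading term has argument exactly
  theta.\<close>

lemma poly_char_poly_eq_det:
  assumes A: "A \<in> carrier_mat n n"
  shows "poly (char_poly A) (z::complex) = Determinant.det (z \<cdot>\<^sub>m 1\<^sub>m n - A)"
proof -
  have "- char_matrix A z = z \<cdot>\<^sub>m 1\<^sub>m n - A"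
    using A by (auto simp: char_matrix_def)
  then show ?thesis using char_poly_matrix[OF A] by simp
qed

lemma resolvent_inverse:
  assumes A: "A \<in> carrier_mat n n" and z: "z \<notin> spectrum A"
  shows "(z \<cdot>\<^sub>m 1\<^sub>m n - A) * resolvent A z = 1\<^sub>m n"
    and "resolvent A z * (z \<cdot>\<^sub>m 1\<^sub>m n - A) = 1\<^sub>m n"
    and "resolvent A z \<in> carrier_mat n n"
proof -
  let ?M = "z \<cdot>\<^sub>m 1\<^sub>m n - A"
  have M: "?M \<in> carrier_mat n n" using A by auto
  have "Determinant.det ?M \<noteq> 0"
    using z eigenvalue_root_char_poly[OF A] poly_char_poly_eq_det[OF A]
    by (auto simp: spectrum_def)
  from det_non_zero_imp_unit[OF M this, of "()"]
  have "mat_inverse ?M \<noteq> None" using mat_inverse(1)[OF M, where b = "()"] by blast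
  then obtain B where B: "mat_inverse ?M = Some B" by auto
  have "resolvent A z = B" using A B by (simp add: resolvent_def)
  then show "(z \<cdot>\<^sub>m 1\<^sub>m n - A) * resolvent A z = 1\<^sub>m n"
    and "resolvent A z * (z \<cdot>\<^sub>m 1\<^sub>m n - A) = 1\<^sub>m n"
    and "resolvent A z \<in> carrier_mat n n"
    using mat_inverse(2)[OF M B] by auto
qed

text \<open>Coefficients beyond the degree vanish, so the range of summation may be any common bound
  \<open>K\<close>; polynomials of different degrees can then be added coefficientwise.\<close>

lemma annihilates_iff:
  assumes A: "A \<in> carrier_mat n n" and K: "degree p \<le> K"
  shows "annihilates p A \<longleftrightarrow>
    (\<forall>i<n. \<forall>j<n. (\<Sum>k\<le>K. coeff p k * (A ^\<^sub>m k) $$ (i, j)) = 0)"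
proof -
  have *: "(\<Sum>k\<le>degree p. coeff p k * (A ^\<^sub>m k) $$ (i, j)) = (\<Sum>k\<le>K. coeff p k * (A ^\<^sub>m k) $$ (i, j))" for i j
    using K by (intro sum.mono_neutral_left) (auto simp: coeff_eq_0)
  show ?thesis
    using A unfolding annihilates_def mat_poly_def mat_eq_iff by (auto simp: *)
qed

lemma annihilates_add:
  assumes A: "A \<in> carrier_mat n n" and "annihilates p A" "annihilates q A"
  shows "annihilates (p + q) A"
proof -
  let ?K = "max (degree p) (degree q)"
  show ?thesis
    using assms(2,3) degree_add_le_max[of p q]
      annihilates_iff[OF A, of p ?K] annihilates_iff[OF A, of q ?K] annihilates_iff[OF A, of "p + q" ?K]
    by (simp add: distrib_right sum.distrib)
qed

lemma annihilates_smult: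
  assumes A: "A \<in> carrier_mat n n" and "annihilates p A"
  shows "annihilates (Polynomial.smult c p) A"
  using assms(2) annihilates_iff[OF A, of p "degree p"]
    annihilates_iff[OF A, of "Polynomial.smult c p" "degree p"]
  by (simp add: mult.assoc sum_distrib_left [symmetric])

text \<open>Multiplication by the indeterminate multiplies \<open>p(A)\<close> by \<open>A\<close>
  on the right, so every new entry is a combination of entries of \<open>p(A)\<close>. With sums and
  scalar multiples this makes the annihilators an ideal.\<close>

lemma annihilates_pCons_0:
  assumes A: "A \<in> carrier_mat n n" and p: "annihilates p A"
  shows "annihilates (pCons 0 p) A"
proof -
  have "(\<Sum>k\<le>Suc (degree p). coeff (pCons 0 p) k * (A ^\<^sub>m k) $$ (i, j)) = 0"
    if i: "i < n" and j: "j < n" for i j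
  proof -
    have Ak: "A ^\<^sub>m k \<in> carrier_mat n n" for k using A by simp
    have "(\<Sum>k\<le>Suc (degree p). coeff (pCons 0 p) k * (A ^\<^sub>m k) $$ (i, j))
      = (\<Sum>k\<le>degree p. coeff p k * (A ^\<^sub>m Suc k) $$ (i, j))"
      by (subst sum.atMost_Suc_shift) simp
    also have "\<dots> = (\<Sum>k\<le>degree p. \<Sum>a<n. coeff p k * (A ^\<^sub>m k) $$ (i, a) * A $$ (a, j))"
      using i j A Ak
      by (intro sum.cong refl)
         (simp add: scalar_prod_def sum_distrib_left mult.assoc atLeast0LessThan carrier_matD[OF Ak])
    also have "\<dots> = (\<Sum>a<n. (\<Sum>k\<le>degree p. coeff p k * (A ^\<^sub>m k) $$ (i, a)) * A $$ (a, j))"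
      by (subst sum.swap) (simp add: sum_distrib_right)
    also have "\<dots> = 0"
      using p i annihilates_iff[OF A, of p "degree p"] by simp
    finally show ?thesis .
  qed
  then show ?thesis
    using annihilates_iff[OF A, of "pCons 0 p" "Suc (degree p)"] degree_pCons_le by blast
qed

lemma annihilates_mult:
  assumes A: "A \<in> carrier_mat n n" and p: "annihilates p A"
  shows "annihilates (q * p) A"
proof (induction q)
  case 0
  then show ?case using annihilates_iff[OF A, of 0 0] by simp
next
  case (pCons a q)
  then show ?case
    using annihilates_add[OF A annihilates_smult[OF A p] annihilates_pCons_0[OF A]] by simp
qed

text \<open>Cayley-Hamilton. Expand the adjugate of X - A in powers of X with matrix coefficients
  \<open>C k\<close>. Comparing coefficients in (X - A) adj(X - A) = chi I gives chi_0 I = - A C_0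
  and chi_(k+1) I = C_k - A C_(k+1); multiplying each relation by the matching power of A makes the
  sum telescope.\<close>

lemma annihilates_char_poly:
  assumes A: "A \<in> carrier_mat n n"
  shows "annihilates (char_poly A) A"
proof -
  let ?M = "char_poly_matrix A" and ?\<chi> = "char_poly A"
  define N where "N = adj_mat ?M"
  have M: "?M \<in> carrier_mat n n" using A by simp
  have N: "N \<in> carrier_mat n n" and MN: "?M * N = ?\<chi> \<cdot>\<^sub>m 1\<^sub>m n"
    using adj_mat[OF M] by (auto simp: N_def char_poly_def)
  define C where "C k = mat n n (\<lambda>ij. coeff (N $$ ij) k)" for k
  have C: "C k \<in> carrier_mat n n" for k by (simp add: C_def)
  have entry: "pCons 0 (N $$ (i,j)) - (\<Sum>a<n. Polynomial.smult (A $$ (i,a)) (N $$ (a,j)))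
      = (if i = j then ?\<chi> else 0)" if i: "i < n" and j: "j < n" for i j
  proof -
    have "(?M * N) $$ (i,j) = (\<Sum>a<n. ?M $$ (i,a) * N $$ (a,j))"
      using i j M N by (simp add: scalar_prod_def atLeast0LessThan)
    also have "\<dots> = (\<Sum>a<n. (if i = a then pCons 0 (N $$ (a,j)) else 0) - Polynomial.smult (A $$ (i,a)) (N $$ (a,j)))"
      using i A by (intro sum.cong) (auto simp: char_poly_matrix_def)
    also have "\<dots> = pCons 0 (N $$ (i,j)) - (\<Sum>a<n. Polynomial.smult (A $$ (i,a)) (N $$ (a,j)))"
      using i by (simp add: sum_subtractf)
    finally have "(?M * N) $$ (i,j) = pCons 0 (N $$ (i,j)) - (\<Sum>a<n. Polynomial.smult (A $$ (i,a)) (N $$ (a,j)))" .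
    moreover have "(?M * N) $$ (i,j) = (if i = j then ?\<chi> else 0)"
      using i j by (simp add: MN)
    ultimately show ?thesis by metis
  qed
  have AC: "(A * C k) $$ (i,j) = (\<Sum>a<n. A $$ (i,a) * coeff (N $$ (a,j)) k)"
    if "i < n" "j < n" for i j k
    using that A C by (simp add: scalar_prod_def atLeast0LessThan C_def)
  have ACc: "A * C k \<in> carrier_mat n n" for k using A C by simp
  note dims = carrier_matD[OF A] carrier_matD[OF ACc] carrier_matD[OF C]
  have c0: "coeff ?\<chi> 0 \<cdot>\<^sub>m 1\<^sub>m n = - (A * C 0)"
  proof (rule eq_matI)
    fix i j assume "i < dim_row (- (A * C 0))" "j < dim_col (- (A * C 0))"
    then have i: "i < n" and j: "j < n" by (auto simp: dims simp del: index_mult_mat)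
    have "coeff (if i = j then ?\<chi> else 0) 0 = - (\<Sum>a<n. A $$ (i,a) * coeff (N $$ (a,j)) 0)"
      by (subst entry[OF i j, symmetric]) (simp add: coeff_sum)
    then show "(coeff ?\<chi> 0 \<cdot>\<^sub>m 1\<^sub>m n) $$ (i, j) = (- (A * C 0)) $$ (i, j)"
      using i j AC[OF i j, of 0] by (auto simp: dims simp del: index_mult_mat(1) split: if_splits)
  qed (auto simp: dims simp del: index_mult_mat)
  have cS: "coeff ?\<chi> (Suc k) \<cdot>\<^sub>m 1\<^sub>m n = C k - A * C (Suc k)" for k
  proof (rule eq_matI)
    fix i j assume "i < dim_row (C k - A * C (Suc k))" "j < dim_col (C k - A * C (Suc k))"
    then have i: "i < n" and j: "j < n" by (auto simp: dims simp del: index_mult_mat)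
    have "coeff (if i = j then ?\<chi> else 0) (Suc k)
        = coeff (N $$ (i,j)) k - (\<Sum>a<n. A $$ (i,a) * coeff (N $$ (a,j)) (Suc k))"
      by (subst entry[OF i j, symmetric]) (simp add: coeff_sum)
    moreover have "C k $$ (i,j) = coeff (N $$ (i,j)) k" using i j by (simp add: C_def)
    ultimately show "(coeff ?\<chi> (Suc k) \<cdot>\<^sub>m 1\<^sub>m n) $$ (i, j) = (C k - A * C (Suc k)) $$ (i, j)"
      using i j AC[OF i j, of "Suc k"] by (auto simp: dims simp del: index_mult_mat(1) split: if_splits)
  qed (auto simp: dims simp del: index_mult_mat)
  define S where "S K = mat n n (\<lambda>ij. \<Sum>k\<le>K. coeff ?\<chi> k * (A ^\<^sub>m k) $$ ij)" for K
  have Ak: "A ^\<^sub>m k \<in> carrier_mat n n" for k using A by simp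
  have S: "S K = - (A ^\<^sub>m Suc K * C K)" for K
  proof (induction K)
    case 0
    have "S 0 = coeff ?\<chi> 0 \<cdot>\<^sub>m 1\<^sub>m n" using A by (auto simp: S_def)
    then show ?case using A by (simp add: c0)
  next
    case (Suc K)
    have "S (Suc K) = S K + A ^\<^sub>m Suc K * (coeff ?\<chi> (Suc K) \<cdot>\<^sub>m 1\<^sub>m n)"
    proof -
      have "A ^\<^sub>m Suc K * (coeff ?\<chi> (Suc K) \<cdot>\<^sub>m 1\<^sub>m n) = coeff ?\<chi> (Suc K) \<cdot>\<^sub>m A ^\<^sub>m Suc K"
        using mult_smult_distrib[OF Ak[of "Suc K"], of "1\<^sub>m n" n "coeff ?\<chi> (Suc K)"] right_mult_one_mat[OF Ak[of "Suc K"]]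
        by simp
      then show ?thesis using carrier_matD[OF Ak[of "Suc K"]] by (intro eq_matI) (auto simp: S_def simp del: pow_mat.simps)
    qed
    also have "A ^\<^sub>m Suc K * (coeff ?\<chi> (Suc K) \<cdot>\<^sub>m 1\<^sub>m n)
      = A ^\<^sub>m Suc K * C K - A ^\<^sub>m Suc K * (A * C (Suc K))"
      unfolding cS by (rule mult_minus_distrib_mat[OF Ak C ACc])
    also have "A ^\<^sub>m Suc K * (A * C (Suc K)) = A ^\<^sub>m Suc (Suc K) * C (Suc K)"
      using assoc_mult_mat[OF Ak[of "Suc K"] A C[of "Suc K"]] by simp
    finally have *: "S (Suc K) = - (A ^\<^sub>m Suc K * C K) + (A ^\<^sub>m Suc K * C K - A ^\<^sub>m Suc (Suc K) * C (Suc K))"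
      using Suc by simp
    have X: "A ^\<^sub>m Suc K * C K \<in> carrier_mat n n" "A ^\<^sub>m Suc (Suc K) * C (Suc K) \<in> carrier_mat n n"
      by (rule mult_carrier_mat[OF Ak C])+
    have "- X + (X - Y) = - Y" if "X \<in> carrier_mat n n" "Y \<in> carrier_mat n n" for X Y :: "complex mat"
      by (intro eq_matI) (use that in auto)
    from this[OF X] show ?case unfolding * .
  qed
  obtain D where D: "\<And>i j. i < n \<Longrightarrow> j < n \<Longrightarrow> degree (N $$ (i,j)) < D"
  proof -
    have "degree (N $$ (i,j)) < Suc (\<Sum>i<n. \<Sum>j<n. degree (N $$ (i,j)))" if "i < n" "j < n" for i j
      using that member_le_sum[of j "{..<n}" "\<lambda>j. degree (N $$ (i,j))"]
        member_le_sum[of i "{..<n}" "\<lambda>i. \<Sum>j<n. degree (N $$ (i,j))"] by force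
    then show ?thesis using that by blast
  qed
  \<comment> \<open>Beyond all degrees in the adjugate the coefficient \<open>C ?K\<close> vanishes,
    and with it the only term left by telescoping; the other bound makes the sum contain all of
    chi.\<close>
  let ?K = "max D (degree ?\<chi>)"
  have C0: "C ?K = 0\<^sub>m n n"
    unfolding C_def using D by (intro eq_matI) (auto intro!: coeff_eq_0 simp: less_max_iff_disj)
  have "S ?K = 0\<^sub>m n n"
    unfolding S C0 using right_mult_zero_mat[OF Ak[of "Suc ?K"], of n] by (auto simp del: pow_mat.simps)
  then have "(\<Sum>k\<le>?K. coeff ?\<chi> k * (A ^\<^sub>m k) $$ (i, j)) = 0" if "i < n" "j < n" for i j
    using that by (auto simp: S_def mat_eq_iff)
  then show ?thesis using annihilates_iff[OF A, of ?\<chi> ?K] by simp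
qed

text \<open>Justifies the definite description. Cayley-Hamilton supplies a nonzero annihilator, so
  one of least degree exists and can be normalised. Two monic ones of least degree have an
  annihilating difference in which the leading terms cancel, so it is zero.\<close>

lemma min_poly_spec:
  assumes A: "A \<in> carrier_mat n n"
  shows "lead_coeff (min_poly A) = 1 \<and> annihilates (min_poly A) A \<and>
     (\<forall>q. q \<noteq> 0 \<and> annihilates q A \<longrightarrow> degree (min_poly A) \<le> degree q)"
proof -
  let ?P = "\<lambda>p. lead_coeff p = 1 \<and> annihilates p A \<and>
     (\<forall>q. q \<noteq> 0 \<and> annihilates q A \<longrightarrow> degree p \<le> degree q)"
  have "char_poly A \<noteq> 0"
    using degree_monic_char_poly[OF A] by auto
  then obtain q where q: "q \<noteq> 0" "annihilates q A"
    and least: "\<And>r. r \<noteq> 0 \<Longrightarrow> annihilates r A \<Longrightarrow> degree q \<le> degree r"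
    using ex_has_least_nat[of "\<lambda>q. q \<noteq> 0 \<and> annihilates q A" "char_poly A" degree]
      annihilates_char_poly[OF A] by blast
  let ?p = "Polynomial.smult (inverse (lead_coeff q)) q"
  have ex: "?P ?p"
    using q least annihilates_smult[OF A] by auto
  have uniq: "p = p'" if p: "?P p" and p': "?P p'" for p p'
  proof (rule ccontr)
    assume ne: "p \<noteq> p'"
    have np: "p \<noteq> 0" "p' \<noteq> 0" using p p' by auto
    have deg: "degree p = degree p'"
      using p p' np by (meson le_antisym)
    have "annihilates (p - p') A"
      using annihilates_add[OF A _ annihilates_smult[OF A, of p' "-1"], of p] p p' by simp
    then have *: "degree p \<le> degree (p - p')" using p ne by simp
    moreover have "degree (p - p') \<le> degree p" using deg degree_diff_le_max[of p p'] by simp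
    ultimately have d: "degree (p - p') = degree p" by (rule antisym[rotated])
    have "coeff p (degree p) = 1" "coeff p' (degree p) = 1" using p p' deg by simp_all
    then have "coeff (p - p') (degree (p - p')) = 0" by (subst d) simp
    then have "p - p' = 0" by (rule iffD1[OF leading_coeff_0_iff])
    then show False using ne by simp
  qed
  have "\<exists>!p. ?P p" by (rule ex_ex1I[OF exI[of ?P, OF ex] uniq])
  from theI'[OF this] show ?thesis unfolding min_poly_def .
qed

lemma min_poly_dvd:
  assumes A: "A \<in> carrier_mat n n" and q: "annihilates q A"
  shows "min_poly A dvd q"
proof (rule ccontr)
  let ?m = "min_poly A"
  note m = min_poly_spec[OF A]
  assume "\<not> ?m dvd q"
  then have r: "q mod ?m \<noteq> 0" by (simp add: mod_eq_0_iff_dvd)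
  have "q mod ?m = q + Polynomial.smult (-1) (q div ?m * ?m)"
    by (simp add: minus_div_mult_eq_mod)
  then have "annihilates (q mod ?m) A"
    using annihilates_add[OF A q annihilates_smult[OF A annihilates_mult[OF A]]] m by metis
  then have "degree ?m \<le> degree (q mod ?m)" using m r by blast
  moreover have "degree (q mod ?m) < degree ?m"
    using m r degree_mod_less[of ?m q] by force
  ultimately show False by simp
qed

lemma scalar_prod_mult_mat_vec:
  assumes B: "B \<in> carrier_mat n n" and y: "y \<in> carrier_vec n" and v: "v \<in> carrier_vec n"
  shows "(B *\<^sub>v y) \<bullet>c v = (\<Sum>i<n. \<Sum>j<n. B $$ (i, j) * vec_index y j * cnj (vec_index v i))"
  using assms
  by (auto simp: scalar_prod_def atLeast0LessThan sum_distrib_right intro!: sum.cong)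

lemma annihilates_scalar_prod:
  assumes A: "A \<in> carrier_mat n n" and p: "annihilates p A"
    and y: "y \<in> carrier_vec n" and v: "v \<in> carrier_vec n"
  shows "(\<Sum>k\<le>degree p. coeff p k * ((A ^\<^sub>m k *\<^sub>v y) \<bullet>c v)) = 0"
proof -
  have Ak: "A ^\<^sub>m k \<in> carrier_mat n n" for k using A by simp
  have "(\<Sum>k\<le>degree p. coeff p k * ((A ^\<^sub>m k *\<^sub>v y) \<bullet>c v))
    = (\<Sum>k\<le>degree p. \<Sum>i<n. \<Sum>j<n. coeff p k * (A ^\<^sub>m k) $$ (i, j) * (vec_index y j * cnj (vec_index v i)))"
    by (simp add: scalar_prod_mult_mat_vec[OF Ak y v] sum_distrib_left mult.assoc)
  also have "\<dots> = (\<Sum>i<n. \<Sum>j<n. \<Sum>k\<le>degree p. coeff p k * (A ^\<^sub>m k) $$ (i, j) * (vec_index y j * cnj (vec_index v i)))"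
    by (subst sum.swap) (intro sum.cong refl sum.swap)
  also have "\<dots> = 0"
    using p annihilates_iff[OF A, of p "degree p"] by (simp flip: sum_distrib_right)
  finally show ?thesis .
qed


text \<open>The divided difference \<open>(q(z) - q(A)) / (z - A)\<close> is a polynomial in \<open>z\<close> and \<open>A\<close>; replacing \<open>A\<^sup>i\<close>
  by \<open>a i\<close>, which will be \<open>v\<^sup>* A\<^sup>i u\<close>, gives the following polynomial. For an annihilating \<open>q\<close> it is
  \<open>q(z) v\<^sup>* (z - A)\<^sup>-\<^sup>1 u\<close>.\<close>

definition numerator_poly :: "complex poly \<Rightarrow> (nat \<Rightarrow> complex) \<Rightarrow> complex poly" where
  "numerator_poly q a = (\<Sum>k\<le>degree q. \<Sum>i<k. monom (coeff q k * a i) (k - Suc i))"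

text \<open>In use, \<open>b i\<close> is v^* A^i y with y = (z - A)^(-1) u, and the recurrence is
  (z - A) y = u tested against v^* A^i. The inner sum over i telescopes to z^k b_0 - b_k, and the
  terms b_k disappear by the annihilation assumption.\<close>

lemma poly_numerator_poly:
  assumes a: "\<And>i. a i = z * b i - b (Suc i)"
    and q: "(\<Sum>k\<le>degree q. coeff q k * b k) = 0"
  shows "poly (numerator_poly q a) z = poly q z * b 0"
proof -
  have *: "(\<Sum>i<k. a i * z ^ (k - Suc i)) = z ^ k * b 0 - b k" for k
  proof (induction k)
    case (Suc k)
    have "(\<Sum>i<Suc k. a i * z ^ (Suc k - Suc i)) = (\<Sum>i<k. z * (a i * z ^ (k - Suc i))) + a k"
      by (auto simp: Suc_diff_Suc mult.left_commute intro!: sum.cong simp flip: power_Suc)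
    also have "\<dots> = z * (z ^ k * b 0 - b k) + a k"
      by (simp add: Suc flip: sum_distrib_left)
    finally show ?case by (simp add: a algebra_simps)
  qed simp
  have "poly (numerator_poly q a) z = (\<Sum>k\<le>degree q. coeff q k * (\<Sum>i<k. a i * z ^ (k - Suc i)))"
    by (simp add: numerator_poly_def poly_sum poly_monom sum_distrib_left mult.assoc)
  also have "\<dots> = poly q z * b 0 - (\<Sum>k\<le>degree q. coeff q k * b k)"
    by (simp add: * poly_altdef right_diff_distrib sum_subtractf sum_distrib_right mult.assoc)
  finally show ?thesis using q by simp
qed

text \<open>A monomial of degree \<open>d\<close> has k = d + 1 + i. Terms with i <
  \<open>\<kappa>\<close> vanish, and i > \<open>\<kappa>\<close> would push k above the degree of
  \<open>q\<close>, so only i = \<open>\<kappa>\<close> is left.\<close>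

lemma coeff_numerator_poly:
  assumes "\<And>i. i < \<kappa> \<Longrightarrow> a i = 0" and "degree q \<le> d + Suc \<kappa>"
  shows "coeff (numerator_poly q a) d = coeff q (d + Suc \<kappa>) * a \<kappa>"
proof -
  have "coeff (numerator_poly q a) d
    = (\<Sum>k\<le>degree q. \<Sum>i<k. if k - Suc i = d then coeff q k * a i else 0)"
    by (simp add: numerator_poly_def coeff_sum)
  also have "\<dots> = (\<Sum>k\<le>degree q. if k = d + Suc \<kappa> then coeff q k * a \<kappa> else 0)"
  proof (intro sum.cong refl)
    fix k assume k: "k \<in> {..degree q}"
    have "(if k - Suc i = d then coeff q k * a i else 0)
        = (if i = \<kappa> then if k = d + Suc \<kappa> then coeff q k * a \<kappa> else 0 else 0)" if "i < k" for i
      using that k assms by (cases "i < \<kappa>") auto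
    then have "(\<Sum>i<k. if k - Suc i = d then coeff q k * a i else 0)
      = (\<Sum>i<k. if i = \<kappa> then if k = d + Suc \<kappa> then coeff q k * a \<kappa> else 0 else 0)"
      by (intro sum.cong) auto
    then show "(\<Sum>i<k. if k - Suc i = d then coeff q k * a i else 0)
      = (if k = d + Suc \<kappa> then coeff q k * a \<kappa> else 0)"
      by auto
  qed
  also have "\<dots> = coeff q (d + Suc \<kappa>) * a \<kappa>"
    by (auto simp: coeff_eq_0)
  finally show ?thesis .
qed

context
  fixes A :: "complex mat" and n :: nat
  assumes A: "A \<in> carrier_mat n n"
begin

lemma finite_spectrum_complex: "finite (spectrum A)"
  using card_finite_spectrum[OF A] by simp

lemma mem_spectrum_iff: "z \<in> spectrum A \<longleftrightarrow> poly (char_poly A) z = 0"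
  using eigenvalue_root_char_poly[OF A] by (simp add: spectrum_def)

text \<open>The spectrum is finite, so an identity of polynomials need only be checked where
  \<open>resolvent\<close> is an inverse.\<close>

lemma poly_eqI_off_spectrum:
  assumes "\<And>z. z \<notin> spectrum A \<Longrightarrow> poly p z = poly q z"
  shows "p = q"
proof (rule ccontr)
  assume "p \<noteq> q"
  then have "finite {z. poly (p - q) z = 0}" by (intro poly_roots_finite) simp
  moreover have "- spectrum A \<subseteq> {z. poly (p - q) z = 0}" using assms by auto
  ultimately have "finite (- spectrum A)" by (rule finite_subset[rotated])
  then show False using finite_spectrum_complex infinite_UNIV_char_0[where 'a = complex]
    by (metis finite_Un Compl_partition)
qed

lemma shift_mult_vec:
  assumes w: "w \<in> carrier_vec n"
  shows "(z \<cdot>\<^sub>m 1\<^sub>m n - A) *\<^sub>v w = z \<cdot>\<^sub>v w - A *\<^sub>v w"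
proof -
  have "(z \<cdot>\<^sub>m 1\<^sub>m n) *\<^sub>v w = z \<cdot>\<^sub>v w"
  proof (rule eq_vecI)
    fix i assume "i < dim_vec (z \<cdot>\<^sub>v w)"
    then have i: "i < n" using w by simp
    have "(\<Sum>j<n. z * (if j = i then 1 else 0) * vec_index w j) = (\<Sum>j<n. if j = i then z * vec_index w j else 0)"
      by (intro sum.cong) auto
    then show "vec_index ((z \<cdot>\<^sub>m 1\<^sub>m n) *\<^sub>v w) i = vec_index (z \<cdot>\<^sub>v w) i"
      using i w by (simp add: scalar_prod_def atLeast0LessThan)
  qed (use w in auto)
  then show ?thesis
    using A w minus_mult_distrib_mat_vec[of "z \<cdot>\<^sub>m 1\<^sub>m n" n n A w] by simp
qed

lemma resolvent_mult_vec:
  assumes u: "u \<in> carrier_vec n" and z: "z \<notin> spectrum A"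
  shows "resolvent A z *\<^sub>v u \<in> carrier_vec n"
    and "z \<cdot>\<^sub>v (resolvent A z *\<^sub>v u) - A *\<^sub>v (resolvent A z *\<^sub>v u) = u"
proof -
  note R = resolvent_inverse[OF A z]
  show y: "resolvent A z *\<^sub>v u \<in> carrier_vec n" using R(3) u by simp
  have "(z \<cdot>\<^sub>m 1\<^sub>m n - A) *\<^sub>v (resolvent A z *\<^sub>v u) = u"
    using assoc_mult_mat_vec[OF minus_carrier_mat[OF A] R(3) u, of "z \<cdot>\<^sub>m 1\<^sub>m n"] R(1) u by simp
  then show "z \<cdot>\<^sub>v (resolvent A z *\<^sub>v u) - A *\<^sub>v (resolvent A z *\<^sub>v u) = u"
    using shift_mult_vec[OF y] by simp
qed

lemma min_poly_root_in_spectrum: "poly (min_poly A) z = 0 \<Longrightarrow> z \<in> spectrum A"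
  using min_poly_dvd[OF A annihilates_char_poly[OF A]] by (auto simp: mem_spectrum_iff)

context
  fixes v :: "complex vec"
  assumes v: "v \<in> carrier_vec n"
begin

lemma poly_numerator_min_poly:
  assumes u: "u \<in> carrier_vec n" and z: "z \<notin> spectrum A"
  shows "poly (numerator_poly (min_poly A) (\<lambda>i. (A ^\<^sub>m i *\<^sub>v u) \<bullet>c v)) z
     = poly (min_poly A) z * ((resolvent A z *\<^sub>v u) \<bullet>c v)"
proof -
  define y where "y = resolvent A z *\<^sub>v u"
  note y = resolvent_mult_vec[OF u z, folded y_def]
  have Ak: "A ^\<^sub>m k \<in> carrier_mat n n" for k using A by simp
  have "(A ^\<^sub>m i *\<^sub>v u) \<bullet>c v = z * ((A ^\<^sub>m i *\<^sub>v y) \<bullet>c v) - (A ^\<^sub>m Suc i *\<^sub>v y) \<bullet>c v" for i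
  proof -
    have Aiy: "A ^\<^sub>m i *\<^sub>v y \<in> carrier_vec n" "A ^\<^sub>m Suc i *\<^sub>v y \<in> carrier_vec n"
      using Ak y by (auto simp del: pow_mat.simps intro: mult_mat_vec_carrier)
    have "A ^\<^sub>m i *\<^sub>v u = z \<cdot>\<^sub>v (A ^\<^sub>m i *\<^sub>v y) - A ^\<^sub>m i *\<^sub>v (A *\<^sub>v y)"
      using A y Ak[of i]
      by (subst y(2)[symmetric], subst mult_minus_distrib_mat_vec[of _ n n]) (auto simp: mult_mat_vec)
    also have "A ^\<^sub>m i *\<^sub>v (A *\<^sub>v y) = A ^\<^sub>m Suc i *\<^sub>v y"
      using assoc_mult_mat_vec[OF Ak A y(1)] by simp
    finally show ?thesis
      using Aiy v by (simp add: minus_scalar_prod_distrib[of _ n] del: pow_mat.simps)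
  qed
  moreover have "(\<Sum>k\<le>degree (min_poly A). coeff (min_poly A) k * ((A ^\<^sub>m k *\<^sub>v y) \<bullet>c v)) = 0"
    using annihilates_scalar_prod[OF A _ y(1) v] min_poly_spec[OF A] by blast
  ultimately show ?thesis
    using poly_numerator_poly[where b = "\<lambda>i. (A ^\<^sub>m i *\<^sub>v y) \<bullet>c v" and z = z] A y(1)
    by (simp add: y_def)
qed

lemma p_uv_eq_numerator:
  assumes u: "u \<in> carrier_vec n"
  shows "p_uv A u v = numerator_poly (min_poly A) (\<lambda>i. (A ^\<^sub>m i *\<^sub>v u) \<bullet>c v)"
  unfolding p_uv_def
proof (rule the_equality)
  fix p assume "\<forall>z. z \<notin> spectrum A \<longrightarrow>
     poly p z = poly (min_poly A) z * ((resolvent A z *\<^sub>v u) \<bullet>c v)"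
  then show "p = numerator_poly (min_poly A) (\<lambda>i. (A ^\<^sub>m i *\<^sub>v u) \<bullet>c v)"
    using poly_numerator_min_poly[OF u] by (intro poly_eqI_off_spectrum) simp
qed (use poly_numerator_min_poly[OF u] in simp)

lemma poly_p_uv:
  assumes "u \<in> carrier_vec n" and "z \<notin> spectrum A"
  shows "poly (p_uv A u v) z = poly (min_poly A) z * ((resolvent A z *\<^sub>v u) \<bullet>c v)"
  using poly_numerator_min_poly[OF assms] p_uv_eq_numerator[OF assms(1)] by simp

text \<open>From the claimed degree upwards a coefficient of the numerator is a single coefficient
  of the minimal polynomial times v^* A^kappa u; at the claimed degree that coefficient is the
  leading one, 1, and above it all are zero.\<close>

lemma degree_p_uv:
  assumes u: "u \<in> carrier_vec n" and "\<kappa> < degree (min_poly A)"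
    and zero: "\<forall>i<\<kappa>. (A ^\<^sub>m i *\<^sub>v u) \<bullet>c v = 0" and nz: "(A ^\<^sub>m \<kappa> *\<^sub>v u) \<bullet>c v \<noteq> 0"
  shows "degree (p_uv A u v) = degree (min_poly A) - \<kappa> - 1"
    and "lead_coeff (p_uv A u v) = (A ^\<^sub>m \<kappa> *\<^sub>v u) \<bullet>c v"
proof -
  let ?l = "degree (min_poly A)"
  have c: "coeff (p_uv A u v) d = coeff (min_poly A) (d + Suc \<kappa>) * ((A ^\<^sub>m \<kappa> *\<^sub>v u) \<bullet>c v)"
    if "?l - \<kappa> - 1 \<le> d" for d
    using that zero unfolding p_uv_eq_numerator[OF u] by (intro coeff_numerator_poly) auto
  have top: "coeff (p_uv A u v) (?l - \<kappa> - 1) = (A ^\<^sub>m \<kappa> *\<^sub>v u) \<bullet>c v"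
    using c[of "?l - \<kappa> - 1"] assms(2) min_poly_spec[OF A] by simp
  show "degree (p_uv A u v) = ?l - \<kappa> - 1"
  proof (rule antisym)
    show "degree (p_uv A u v) \<le> ?l - \<kappa> - 1"
    proof (rule degree_le, intro allI impI)
      fix d assume "?l - \<kappa> - 1 < d"
      then show "coeff (p_uv A u v) d = 0" using c[of d] assms(2) by (simp add: coeff_eq_0)
    qed
  qed (use top nz in \<open>auto intro: le_degree\<close>)
  then show "lead_coeff (p_uv A u v) = (A ^\<^sub>m \<kappa> *\<^sub>v u) \<bullet>c v" using top by simp
qed

text \<open>The resolvent identity. With w = (zeta - A)^(-1) u one has u = (zeta - z) w + (z - A) w,
  hence (z - A)^(-1) u = (zeta - z) (z - A)^(-1) w + w; pairing with v and multiplying by the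
  minimal polynomial gives polynomials.\<close>

lemma p_uv_resolvent:
  assumes u: "u \<in> carrier_vec n" and \<zeta>: "\<zeta> \<notin> spectrum A"
  shows "p_uv A u v = Polynomial.smult ((resolvent A \<zeta> *\<^sub>v u) \<bullet>c v) (min_poly A)
     - [:- \<zeta>, 1:] * p_uv A (resolvent A \<zeta> *\<^sub>v u) v"
proof (rule poly_eqI_off_spectrum)
  fix z assume z: "z \<notin> spectrum A"
  define w where "w = resolvent A \<zeta> *\<^sub>v u"
  note w = resolvent_mult_vec[OF u \<zeta>, folded w_def]
  define x where "x = resolvent A z *\<^sub>v w"
  note x = resolvent_mult_vec[OF w(1) z, folded x_def]
  have Aw: "A *\<^sub>v w \<in> carrier_vec n" using A w by simp
  have u_eq: "u = (\<zeta> - z) \<cdot>\<^sub>v w + (z \<cdot>\<^sub>v w - A *\<^sub>v w)"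
  proof (rule eq_vecI)
    fix i assume "i < dim_vec ((\<zeta> - z) \<cdot>\<^sub>v w + (z \<cdot>\<^sub>v w - A *\<^sub>v w))"
    then have i: "i < n" using A by simp
    have "vec_index u i = vec_index (\<zeta> \<cdot>\<^sub>v w - A *\<^sub>v w) i" using w(2) by simp
    also have "\<dots> = \<zeta> * vec_index w i - vec_index (A *\<^sub>v w) i"
      using i carrier_vecD[OF w(1)] carrier_vecD[OF Aw] by (simp del: index_mult_mat_vec)
    finally show "vec_index u i = vec_index ((\<zeta> - z) \<cdot>\<^sub>v w + (z \<cdot>\<^sub>v w - A *\<^sub>v w)) i"
      using i carrier_vecD[OF w(1)] carrier_vecD[OF Aw]
      by (simp add: algebra_simps del: index_mult_mat_vec)
  qed (use A carrier_vecD[OF u] in simp)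
  have inv: "resolvent A z *\<^sub>v (z \<cdot>\<^sub>v w - A *\<^sub>v w) = w"
  proof -
    have "resolvent A z *\<^sub>v ((z \<cdot>\<^sub>m 1\<^sub>m n - A) *\<^sub>v w) = w"
      using assoc_mult_mat_vec[OF resolvent_inverse(3)[OF A z] minus_carrier_mat[OF A] w(1), of "z \<cdot>\<^sub>m 1\<^sub>m n"]
        resolvent_inverse(2)[OF A z] w(1) by simp
    then show ?thesis by (simp add: shift_mult_vec[OF w(1)])
  qed
  have "resolvent A z *\<^sub>v u = (\<zeta> - z) \<cdot>\<^sub>v x + w"
    using resolvent_inverse(3)[OF A z] w Aw
    by (subst u_eq, subst mult_add_distrib_mat_vec[of _ n n]) (auto simp: inv x_def mult_mat_vec)
  then have res: "(resolvent A z *\<^sub>v u) \<bullet>c v = (\<zeta> - z) * (x \<bullet>c v) + w \<bullet>c v"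
    using x(1) w(1) v by (simp add: add_scalar_prod_distrib[of _ n])
  show "poly (p_uv A u v) z = poly (Polynomial.smult ((resolvent A \<zeta> *\<^sub>v u) \<bullet>c v) (min_poly A)
     - [:- \<zeta>, 1:] * p_uv A (resolvent A \<zeta> *\<^sub>v u) v) z"
    unfolding poly_p_uv[OF u z] res by (simp add: poly_p_uv[OF w(1) z] algebra_simps flip: w_def x_def)
qed

text \<open>Iterating the previous lemma divides a zero \<open>\<zeta>\<close> out of \<open>p\<^sub>u\<^sub>v\<close> and replaces \<open>u\<close> by
  \<open>(\<zeta> - A)\<^sup>-\<^sup>1 u\<close>, one order at a time.\<close>

lemma p_uv_factor_root:
  assumes \<zeta>: "\<zeta> \<notin> spectrum A" and "u \<in> carrier_vec n"
    and "[:- \<zeta>, 1:] ^ k dvd p_uv A u v"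
  shows "\<exists>h. p_uv A u v = [:- \<zeta>, 1:] ^ k * h \<and>
    poly h \<zeta> = (-1) ^ k * poly (min_poly A) \<zeta> * ((resolvent A \<zeta> ^\<^sub>m (k + 1) *\<^sub>v u) \<bullet>c v)"
  using assms(2,3)
proof (induction k arbitrary: u)
  case 0
  then show ?case using poly_p_uv[OF _ \<zeta>] resolvent_inverse(3)[OF A \<zeta>] by auto
next
  case (Suc k)
  let ?w = "resolvent A \<zeta> *\<^sub>v u"
  have w: "?w \<in> carrier_vec n" using resolvent_mult_vec(1)[OF Suc.prems(1) \<zeta>] .
  have R: "resolvent A \<zeta> \<in> carrier_mat n n" using resolvent_inverse(3)[OF A \<zeta>] .
  have "poly (p_uv A u v) \<zeta> = 0" using Suc.prems(2) by (auto elim!: dvdE)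
  \<comment> \<open>Off the spectrum the minimal polynomial does not vanish, so a zero of
    \<open>p_uv A u v\<close> kills the first term of \<open>p_uv_resolvent\<close>. What is left
    carries one minus sign per order, whence \<open>(-1) ^ k\<close>.\<close>
  then have "?w \<bullet>c v = 0"
    using poly_p_uv[OF Suc.prems(1) \<zeta>] min_poly_root_in_spectrum \<zeta> by auto
  then have eq: "p_uv A u v = [:- \<zeta>, 1:] * (- p_uv A ?w v)"
    using p_uv_resolvent[OF Suc.prems(1) \<zeta>] by simp
  then have "[:- \<zeta>, 1:] ^ k dvd p_uv A ?w v"
    using Suc.prems(2) by (simp del: mult_pCons_left mult_minus_right)
  from Suc.IH[OF w this] obtain h where h: "p_uv A ?w v = [:- \<zeta>, 1:] ^ k * h"
    "poly h \<zeta> = (-1) ^ k * poly (min_poly A) \<zeta> * ((resolvent A \<zeta> ^\<^sub>m (k + 1) *\<^sub>v ?w) \<bullet>c v)"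
    by blast
  have "resolvent A \<zeta> ^\<^sub>m (k + 1) *\<^sub>v ?w = resolvent A \<zeta> ^\<^sub>m (Suc k + 1) *\<^sub>v u"
    using assoc_mult_mat_vec[OF pow_carrier_mat[OF R] R Suc.prems(1), of "k + 1"] by simp
  then show ?case
    using h eq by (intro exI[of _ "- h"]) (simp add: mult.assoc del: mult_pCons_left)
qed

end

end

text \<open>The bordered matrix \<open>?B\<close> with blocks M, X, V, 1, where XV = tau u v^*, is
  evaluated in two ways. Clearing its upper right block leaves M - XV; factoring out M instead
  leaves the scalar Schur complement 1 - V R X.\<close>

lemma det_rank_one_update:
  fixes M :: "complex mat"
  assumes M: "M \<in> carrier_mat n n" and R: "R \<in> carrier_mat n n" "M * R = 1\<^sub>m n"
    and u: "u \<in> carrier_vec n" and v: "v \<in> carrier_vec n"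
  shows "Determinant.det (M - \<tau> \<cdot>\<^sub>m outer u v) = Determinant.det M * (1 - \<tau> * ((R *\<^sub>v u) \<bullet>c v))"
proof -
  let ?det = Determinant.det
  define X where "X = mat n 1 (\<lambda>(i, _). \<tau> * vec_index u i)"
  define V where "V = mat 1 n (\<lambda>(_, j). cnj (vec_index v j))"
  define S where "S = 1\<^sub>m 1 - V * (R * X)"
  have X: "X \<in> carrier_mat n 1" and V: "V \<in> carrier_mat 1 n" by (auto simp: X_def V_def)
  have RX: "R * X \<in> carrier_mat n 1" using R X by simp
  have VRX: "V * (R * X) \<in> carrier_mat 1 1" using V RX by simp
  have S: "S \<in> carrier_mat 1 1" unfolding S_def by (rule minus_carrier_mat[OF VRX])
  have XV: "X * V = \<tau> \<cdot>\<^sub>m outer u v"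
    using u v by (intro eq_matI) (auto simp: X_def V_def outer_def scalar_prod_def)
  let ?B = "four_block_mat M X V (1\<^sub>m 1)"
  have B: "?B \<in> carrier_mat (n + 1) (n + 1)" using M by auto
  have one: "1\<^sub>m n \<in> carrier_mat n n" "1\<^sub>m 1 \<in> carrier_mat 1 1" by auto
  have "four_block_mat (1\<^sub>m n) (- X) (0\<^sub>m 1 n) (1\<^sub>m 1) * ?B = four_block_mat (M - X * V) (0\<^sub>m n 1) V (1\<^sub>m 1)"
  proof (subst mult_four_block_mat[OF one(1) _ _ one(2) M X V one(2)])
    have "1\<^sub>m n * M + - X * V = M - X * V"
      using M X V by (intro eq_matI) auto
    moreover have "1\<^sub>m n * X + - X * 1\<^sub>m 1 = 0\<^sub>m n 1"
      using X by (intro eq_matI) auto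
    moreover have "0\<^sub>m 1 n * M + 1\<^sub>m 1 * V = V" "0\<^sub>m 1 n * X + 1\<^sub>m 1 * 1\<^sub>m 1 = 1\<^sub>m 1"
      using M X V by auto
    ultimately show "four_block_mat (1\<^sub>m n * M + - X * V) (1\<^sub>m n * X + - X * 1\<^sub>m 1)
       (0\<^sub>m 1 n * M + 1\<^sub>m 1 * V) (0\<^sub>m 1 n * X + 1\<^sub>m 1 * 1\<^sub>m 1) = four_block_mat (M - X * V) (0\<^sub>m n 1) V (1\<^sub>m 1)"
      by simp
  qed (use X in auto)
  then have "?det (four_block_mat (1\<^sub>m n) (- X) (0\<^sub>m 1 n) (1\<^sub>m 1)) * ?det ?B
    = ?det (four_block_mat (M - X * V) (0\<^sub>m n 1) V (1\<^sub>m 1))"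
    using det_mult[OF four_block_carrier_mat[OF one] B, of "- X" "0\<^sub>m 1 n"] by simp
  also have "?det (four_block_mat (M - X * V) (0\<^sub>m n 1) V (1\<^sub>m 1)) = ?det (M - X * V)"
    using det_four_block_mat_upper_right_zero[OF minus_carrier_mat[OF mult_carrier_mat[OF X V]] refl V one(2), of M]
    by simp
  also have "?det (four_block_mat (1\<^sub>m n) (- X) (0\<^sub>m 1 n) (1\<^sub>m 1)) = 1"
    using det_four_block_mat_lower_left_zero[of "1\<^sub>m n" n "- X" 1 "0\<^sub>m 1 n" "1\<^sub>m 1"] X by simp
  finally have d1: "?det ?B = ?det (M - X * V)" by simp
  have "four_block_mat M (0\<^sub>m n 1) V (1\<^sub>m 1) * four_block_mat (1\<^sub>m n) (R * X) (0\<^sub>m 1 n) S = ?B"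
  proof (subst mult_four_block_mat[OF M _ V one(2) one(1) RX _ S])
    have "M * (R * X) = X"
      using assoc_mult_mat[OF M R(1) X] R(2) X by simp
    then have "M * (R * X) + 0\<^sub>m n 1 * S = X" using X S by simp
    moreover have "M * 1\<^sub>m n + 0\<^sub>m n 1 * 0\<^sub>m 1 n = M" "V * 1\<^sub>m n + 1\<^sub>m 1 * 0\<^sub>m 1 n = V"
      using M V by auto
    moreover have "V * (R * X) + 1\<^sub>m 1 * S = 1\<^sub>m 1"
    proof -
      have "Y + (1\<^sub>m 1 - Y) = 1\<^sub>m 1" if "Y \<in> carrier_mat 1 1" for Y :: "complex mat"
        by (intro eq_matI) (use that in auto)
      from this[OF VRX] show ?thesis unfolding left_mult_one_mat[OF S] unfolding S_def .
    qed
    ultimately show "four_block_mat (M * 1\<^sub>m n + 0\<^sub>m n 1 * 0\<^sub>m 1 n) (M * (R * X) + 0\<^sub>m n 1 * S)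
       (V * 1\<^sub>m n + 1\<^sub>m 1 * 0\<^sub>m 1 n) (V * (R * X) + 1\<^sub>m 1 * S) = ?B" by simp
  qed auto
  then have "?det ?B = ?det (four_block_mat M (0\<^sub>m n 1) V (1\<^sub>m 1)) * ?det (four_block_mat (1\<^sub>m n) (R * X) (0\<^sub>m 1 n) S)"
    using det_mult[OF four_block_carrier_mat[OF M one(2)] four_block_carrier_mat[OF one(1) S], of "0\<^sub>m n 1" V "R * X" "0\<^sub>m 1 n"] by simp
  also have "\<dots> = ?det M * ?det S"
    using det_four_block_mat_upper_right_zero[of M n "0\<^sub>m n 1" 1 V "1\<^sub>m 1"]
      det_four_block_mat_lower_left_zero[of "1\<^sub>m n" n "R * X" 1 "0\<^sub>m 1 n" S] M V RX S by simp
  also have "?det S = S $$ (0, 0)" using S by (rule det_single)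
  also have "S $$ (0, 0) = 1 - \<tau> * ((R *\<^sub>v u) \<bullet>c v)"
  proof -
    have "(V * (R * X)) $$ (0, 0) = (\<Sum>i<n. cnj (vec_index v i) * (\<Sum>j<n. R $$ (i, j) * (\<tau> * vec_index u j)))"
      using V R(1) X by (simp add: scalar_prod_def atLeast0LessThan V_def X_def)
    also have "\<dots> = \<tau> * ((R *\<^sub>v u) \<bullet>c v)"
      unfolding scalar_prod_mult_mat_vec[OF R(1) u v] sum_distrib_left
      by (intro sum.cong refl) (simp add: mult_ac)
    finally have "(V * (R * X)) $$ (0, 0) = \<tau> * ((R *\<^sub>v u) \<bullet>c v)" .
    moreover have "S $$ (0, 0) = 1 - (V * (R * X)) $$ (0, 0)"
      unfolding S_def by (subst index_minus_mat) (use VRX in auto)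
    ultimately show ?thesis by (simp only:)
  qed
  finally show ?thesis using d1 XV by simp
qed

text \<open>Off the spectrum of \<open>A\<close> the factor 1 - tau v^* (z - A)^(-1) u turns into m
  - tau p once the minimal polynomial m is multiplied in. The exact quotient of the two polynomials
  of \<open>A\<close> passes unchanged into every perturbation, which is the origin of
  \<open>frozen_eigenvalues\<close>.\<close>

lemma char_poly_perturb:
  assumes A: "A \<in> carrier_mat n n" and u: "u \<in> carrier_vec n" and v: "v \<in> carrier_vec n"
  shows "char_poly (perturb A u v \<tau>)
    = (char_poly A div min_poly A) * (min_poly A - Polynomial.smult \<tau> (p_uv A u v))"
proof (rule poly_eqI_off_spectrum[OF A])
  fix z assume z: "z \<notin> spectrum A"
  note R = resolvent_inverse[OF A z]
  have P: "perturb A u v \<tau> \<in> carrier_mat n n" using A u v by (auto simp: perturb_def outer_def)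
  have "z \<cdot>\<^sub>m 1\<^sub>m n - perturb A u v \<tau> = (z \<cdot>\<^sub>m 1\<^sub>m n - A) - \<tau> \<cdot>\<^sub>m outer u v"
    using A u v by (intro eq_matI) (auto simp: perturb_def outer_def)
  then have "poly (char_poly (perturb A u v \<tau>)) z
    = poly (char_poly A) z * (1 - \<tau> * ((resolvent A z *\<^sub>v u) \<bullet>c v))"
    using poly_char_poly_eq_det[OF P] poly_char_poly_eq_det[OF A]
      det_rank_one_update[OF minus_carrier_mat[OF A] R(3) R(1) u v, of \<tau>] by simp
  also have "char_poly A = (char_poly A div min_poly A) * min_poly A"
    using min_poly_dvd[OF A annihilates_char_poly[OF A]] by simp
  finally show "poly (char_poly (perturb A u v \<tau>)) z
    = poly ((char_poly A div min_poly A) * (min_poly A - Polynomial.smult \<tau> (p_uv A u v))) z"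
    using poly_p_uv[OF A v u z] by (simp add: algebra_simps)
qed

subsection \<open>Local branches of solutions\<close>

text \<open>Source of every error constant: the derivative is bounded on the compact disc of half
  the radius, which lies inside the open disc of holomorphy.\<close>

lemma holomorphic_lipschitz_at:
  fixes f :: "complex \<Rightarrow> complex"
  assumes hol: "f holomorphic_on ball 0 \<delta>" and "0 < \<delta>"
  obtains C where "0 \<le> C" "\<And>s. norm s < \<delta> / 2 \<Longrightarrow> norm (f s - f 0) \<le> C * norm s"
proof -
  let ?K = "cball (0::complex) (\<delta> / 2)"
  have sub: "?K \<subseteq> ball 0 \<delta>" using \<open>0 < \<delta>\<close> by auto
  have "deriv f holomorphic_on ball 0 \<delta>" by (rule holomorphic_deriv[OF hol]) auto
  then have "continuous_on ?K (deriv f)"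
    using sub by (meson holomorphic_on_imp_continuous_on continuous_on_subset)
  then have "compact (deriv f ` ?K)" by (rule compact_continuous_image) simp
  then obtain B where B: "B > 0" "\<And>s. s \<in> ?K \<Longrightarrow> norm (deriv f s) \<le> B"
    using compact_imp_bounded bounded_pos by (metis imageI)
  show ?thesis
  proof (rule that)
    fix s :: complex assume "norm s < \<delta> / 2"
    then have s: "s \<in> ?K" by simp
    have d: "(f has_field_derivative deriv f x) (at x within ?K)" if "x \<in> ?K" for x
      using that sub hol by (meson holomorphic_derivI open_ball has_field_derivative_at_within subsetD)
    show "norm (f s - f 0) \<le> B * norm s"
      using field_differentiable_bound[OF convex_cball d B(2) s, of 0] \<open>0 < \<delta>\<close> by simp
  qed (use B in simp)
qed

text \<open>The equation \<open>x\<^sup>k H(x) = s\<^sup>k\<close> becomes \<open>x G(x) = s\<close> with \<open>G\<close> a holomorphic \<open>k\<close>-th root of \<open>H\<close>, so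
  it is solved by the local inverse of \<open>x G(x)\<close>.\<close>

lemma local_power_inverse:
  fixes H :: "complex \<Rightarrow> complex"
  assumes "0 < \<epsilon>" and holH: "H holomorphic_on ball 0 \<epsilon>" and "0 < k" and H0: "H 0 = b ^ k" and "b \<noteq> 0"
  obtains \<phi> \<delta> where "0 < \<delta>" "\<phi> holomorphic_on ball 0 \<delta>" "\<phi> 0 = inverse b"
    "\<And>s. s \<in> ball 0 \<delta> \<Longrightarrow> \<phi> s \<noteq> 0" "\<And>s. s \<in> ball 0 \<delta> \<Longrightarrow> s * \<phi> s \<in> ball 0 \<epsilon>"
    "\<And>s. s \<in> ball 0 \<delta> \<Longrightarrow> (s * \<phi> s) ^ k * H (s * \<phi> s) = s ^ k"
    "inj_on (\<lambda>s. s * \<phi> s) (ball 0 \<delta>)"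
proof -
  have "isCont (\<lambda>x. H x / b ^ k) 0"
  proof -
    have "isCont H 0"
      using holomorphic_on_imp_continuous_on[OF holH] \<open>0 < \<epsilon>\<close>
      by (simp add: continuous_on_eq_continuous_at)
    then show ?thesis using \<open>b \<noteq> 0\<close> by (intro continuous_intros) auto
  qed
  \<comment> \<open>Keeping \<open>H x / b ^ k\<close> within distance 1 of its value 1 at the
    centre keeps it off the cut of \<open>Ln\<close>.\<close>
  then obtain r0 where r0: "r0 > 0" "\<And>x. norm x < r0 \<Longrightarrow> dist (H x / b ^ k) (H 0 / b ^ k) < 1"
    unfolding continuous_at_eps_delta by (force dest: spec[of _ 1] simp: dist_norm)
  define r where "r = min r0 \<epsilon>"
  have r: "r > 0" "r \<le> \<epsilon>" using r0 \<open>0 < \<epsilon>\<close> by (auto simp: r_def)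
  have nonpos: "H x / b ^ k \<notin> \<real>\<^sub>\<le>\<^sub>0" if "x \<in> ball 0 r" for x
  proof
    assume "H x / b ^ k \<in> \<real>\<^sub>\<le>\<^sub>0"
    then obtain y where y: "H x / b ^ k = of_real y" "y \<le> 0" by (auto elim: nonpos_Reals_cases)
    have "dist (H x / b ^ k) 1 < 1"
      using r0(2)[of x] that \<open>b \<noteq> 0\<close> by (simp add: r_def H0)
    then have "norm (complex_of_real (y - 1)) < 1" unfolding y dist_norm by simp
    then show False using y(2) by (simp only: norm_of_real)
  qed
  \<comment> \<open>Dividing by \<open>b ^ k\<close> inside and restoring \<open>b\<close> outside
    selects the k-th root of \<open>H\<close> with value \<open>b\<close> at 0; as the exponential
    never vanishes, \<open>G\<close> has no zeros.\<close>
  define G where "G x = b * exp (Ln (H x / b ^ k) / of_nat k)" for x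
  have holG: "G holomorphic_on ball 0 r"
    unfolding G_def using nonpos holH r(2) \<open>b \<noteq> 0\<close> \<open>0 < k\<close>
    by (intro holomorphic_intros) (auto intro: holomorphic_on_subset)
  have Gk: "G x ^ k = H x" if "x \<in> ball 0 r" for x
  proof -
    have "H x / b ^ k \<noteq> 0" using nonpos[OF that] by fastforce
    then have "exp (Ln (H x / b ^ k) / of_nat k) ^ k = H x / b ^ k"
      using \<open>0 < k\<close> \<open>b \<noteq> 0\<close> by (simp flip: exp_of_nat_mult)
    then show ?thesis using \<open>b \<noteq> 0\<close> by (simp add: G_def power_mult_distrib)
  qed
  have G0: "G 0 = b" using H0 \<open>b \<noteq> 0\<close> by (simp add: G_def)
  have Gnz: "G x \<noteq> 0" for x using \<open>b \<noteq> 0\<close> by (simp add: G_def)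
  define f where "f x = x * G x" for x
  have holf: "f holomorphic_on ball 0 r"
    unfolding f_def by (intro holomorphic_intros holG)
  have "(G has_field_derivative deriv G 0) (at 0)"
    using r(1) by (intro holomorphic_derivI[OF holG]) auto
  then have "(f has_field_derivative G 0) (at 0)"
    unfolding f_def by (auto intro!: derivative_eq_intros)
  then have df: "deriv f 0 \<noteq> 0" using \<open>b \<noteq> 0\<close> by (simp add: DERIV_imp_deriv G0)
  obtain r' where r': "r' > 0" "ball (0::complex) r' \<subseteq> ball 0 r" "inj_on f (ball 0 r')"
    by (rule has_complex_derivative_locally_injective
          [OF holf centre_in_ball[THEN iffD2, OF r(1)] open_ball df]) (rule that)
  have holf': "f holomorphic_on ball 0 r'" using holf r'(2) by (rule holomorphic_on_subset)
  obtain g where g: "g holomorphic_on (f ` ball 0 r')" "\<And>z. z \<in> ball 0 r' \<Longrightarrow> g (f z) = z"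
    by (rule holomorphic_has_inverse[OF holf' open_ball r'(3)]) (rule that)
  have "open (f ` ball 0 r')" by (rule open_mapping_thm3[OF holf' _ r'(3)]) simp
  moreover have "0 \<in> f ` ball 0 r'" using r'(1) by (auto simp: f_def intro!: image_eqI[of _ _ 0])
  ultimately obtain \<delta> where \<delta>: "\<delta> > 0" "ball 0 \<delta> \<subseteq> f ` ball 0 r'"
    using openE by blast
  \<comment> \<open>The inverse \<open>g\<close> of x G(x) satisfies g(s) = s / G(g(s)). Writing the
    solution as \<open>s * \<phi> s\<close> with this reciprocal makes \<open>\<phi>\<close>
    holomorphic and nonzero at 0 without any division by \<open>s\<close>.\<close>
  define \<phi> where "\<phi> s = inverse (G (g s))" for s
  have key: "g s \<in> ball 0 r'" "f (g s) = s" "s * \<phi> s = g s" if s: "s \<in> ball 0 \<delta>" for s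
  proof -
    obtain x where x: "x \<in> ball 0 r'" "s = f x" using s \<delta>(2) by auto
    then have "g s = x" using g(2) by simp
    then show "g s \<in> ball 0 r'" "f (g s) = s" "s * \<phi> s = g s"
      using x Gnz[of x] by (auto simp: \<phi>_def f_def)
  qed
  have holg: "g holomorphic_on ball 0 \<delta>" using g(1) \<delta>(2) by (rule holomorphic_on_subset)
  show ?thesis
  proof (rule that[of \<delta> \<phi>])
    have "(\<lambda>s. G (g s)) holomorphic_on ball 0 \<delta>"
    proof -
      have "g ` ball 0 \<delta> \<subseteq> ball 0 r" using key(1) r'(2) by blast
      then show ?thesis using holomorphic_on_compose_gen[OF holg holG] by (simp add: o_def)
    qed
    then show "\<phi> holomorphic_on ball 0 \<delta>"
      unfolding \<phi>_def using Gnz by (intro holomorphic_intros) auto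
    have "g 0 = 0" using g(2)[of 0] r'(1) by (simp add: f_def)
    then show "\<phi> 0 = inverse b" by (simp add: \<phi>_def G0)
    show "\<phi> s \<noteq> 0" for s using Gnz by (simp add: \<phi>_def)
    show "s * \<phi> s \<in> ball 0 \<epsilon>" if "s \<in> ball 0 \<delta>" for s
      using key(1,3)[OF that] r'(2) r(2) by (force simp: subset_iff)
    show "(s * \<phi> s) ^ k * H (s * \<phi> s) = s ^ k" if "s \<in> ball 0 \<delta>" for s
    proof -
      have "g s \<in> ball 0 r" using key(1)[OF that] r'(2) by blast
      then have "(g s) ^ k * H (g s) = (f (g s)) ^ k"
        by (simp add: f_def power_mult_distrib Gk)
      then show ?thesis using key[OF that] by simp
    qed
    show "inj_on (\<lambda>s. s * \<phi> s) (ball 0 \<delta>)"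
      using key(2,3) by (intro inj_onI) metis
  qed (use \<delta> in simp)
qed

text \<open>\<open>s \<phi>(s)\<close> is the inverse of a function with a simple zero of derivative \<open>b\<close> at \<open>0\<close>. The last
  assumption says that \<open>s \<phi>(s)\<close> and \<open>s / b\<close> agree to first order in the derivative of
  \<open>1 / (s \<phi>(s))\<close>, rescaled.\<close>

locale branch =
  fixes k :: nat and b :: complex and \<phi> :: "complex \<Rightarrow> complex" and \<delta> C :: real
  assumes k_pos: "0 < k" and b_nz: "b \<noteq> 0" and \<delta>_pos: "0 < \<delta>" and C_nonneg: "0 \<le> C"
    and hol: "\<phi> holomorphic_on ball 0 \<delta>"
    and nz: "norm s < \<delta> \<Longrightarrow> \<phi> s \<noteq> 0"
    and inj: "inj_on (\<lambda>s. s * \<phi> s) (ball 0 \<delta>)"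
    and bound: "norm s < \<delta> \<Longrightarrow> norm (\<phi> s - inverse b) \<le> C * norm s"
    and bound_inverse: "norm s < \<delta> \<Longrightarrow> norm (inverse (\<phi> s) - b) \<le> C * norm s"
    and bound_deriv: "norm s < \<delta> \<Longrightarrow>
      norm ((\<phi> s + s * deriv \<phi> s) / (\<phi> s)\<^sup>2 - b ^ k * \<phi> s ^ (k - 1)) \<le> C * norm s"

lemma branch_exists:
  fixes H :: "complex \<Rightarrow> complex"
  assumes \<epsilon>: "0 < \<epsilon>" and holH: "H holomorphic_on ball 0 \<epsilon>" and k: "0 < k" and H0: "H 0 = b ^ k" and b: "b \<noteq> 0"
  obtains \<phi> \<delta> C where "branch k b \<phi> \<delta> C"
    "\<And>s. norm s < \<delta> \<Longrightarrow> norm (s * \<phi> s) < \<epsilon> \<and> (s * \<phi> s) ^ k * H (s * \<phi> s) = s ^ k"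
proof -
  obtain \<phi> \<delta> where \<phi>: "0 < \<delta>" "\<phi> holomorphic_on ball 0 \<delta>" "\<phi> 0 = inverse b"
    "\<And>s. s \<in> ball 0 \<delta> \<Longrightarrow> \<phi> s \<noteq> 0" "\<And>s. s \<in> ball 0 \<delta> \<Longrightarrow> s * \<phi> s \<in> ball 0 \<epsilon>"
    "\<And>s. s \<in> ball 0 \<delta> \<Longrightarrow> (s * \<phi> s) ^ k * H (s * \<phi> s) = s ^ k"
    "inj_on (\<lambda>s. s * \<phi> s) (ball 0 \<delta>)"
    by (rule local_power_inverse[OF assms]) (rule that)
  \<comment> \<open>Both terms of \<open>E\<close> equal \<open>b\<close> at 0, so \<open>E\<close>
    vanishes there and its Lipschitz bound is the linear estimate
    \<open>bound_deriv\<close>.\<close>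
  define E where "E s = (\<phi> s + s * deriv \<phi> s) / (\<phi> s)\<^sup>2 - b ^ k * \<phi> s ^ (k - 1)" for s
  have "deriv \<phi> holomorphic_on ball 0 \<delta>" by (rule holomorphic_deriv[OF \<phi>(2)]) simp
  then have holE: "E holomorphic_on ball 0 \<delta>"
    unfolding E_def using \<phi>(2,4) by (intro holomorphic_intros) auto
  have holI: "(\<lambda>s. inverse (\<phi> s)) holomorphic_on ball 0 \<delta>"
    using \<phi>(2,4) by (intro holomorphic_intros) auto
  have "b ^ k * inverse b ^ (k - 1) = b"
    using k b by (cases k) (simp_all add: power_inverse)
  moreover have "inverse b / (inverse b)\<^sup>2 = b" using b by (simp add: power2_eq_square field_simps)
  ultimately have E0: "E 0 = 0" by (simp add: E_def \<phi>(3))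
  obtain C1 where C1: "0 \<le> C1" "\<And>s. norm s < \<delta> / 2 \<Longrightarrow> norm (\<phi> s - \<phi> 0) \<le> C1 * norm s"
    using holomorphic_lipschitz_at[OF \<phi>(2,1)] by metis
  obtain C2 where C2: "0 \<le> C2" "\<And>s. norm s < \<delta> / 2 \<Longrightarrow> norm (inverse (\<phi> s) - inverse (\<phi> 0)) \<le> C2 * norm s"
    using holomorphic_lipschitz_at[OF holI \<phi>(1)] by metis
  obtain C3 where C3: "0 \<le> C3" "\<And>s. norm s < \<delta> / 2 \<Longrightarrow> norm (E s - E 0) \<le> C3 * norm s"
    using holomorphic_lipschitz_at[OF holE \<phi>(1)] by metis
  let ?C = "C1 + C2 + C3"
  show ?thesis
  proof (rule that[of \<phi> "\<delta> / 2" ?C])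
    show "branch k b \<phi> (\<delta> / 2) ?C"
    proof
      show "\<phi> holomorphic_on ball 0 (\<delta> / 2)" "inj_on (\<lambda>s. s * \<phi> s) (ball 0 (\<delta> / 2))"
        using \<phi>(1) by (auto intro: holomorphic_on_subset[OF \<phi>(2)] inj_on_subset[OF \<phi>(7)])
      fix s :: complex assume s: "norm s < \<delta> / 2"
      have le: "C1 * norm s \<le> ?C * norm s" "C2 * norm s \<le> ?C * norm s" "C3 * norm s \<le> ?C * norm s"
        using C1 C2 C3 by (auto intro!: mult_right_mono)
      show "norm (\<phi> s - inverse b) \<le> ?C * norm s"
        using order_trans[OF C1(2)[OF s] le(1)] \<phi>(3) by simp
      show "norm (inverse (\<phi> s) - b) \<le> ?C * norm s"
        using order_trans[OF C2(2)[OF s] le(2)] \<phi>(3) by simp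
      show "norm ((\<phi> s + s * deriv \<phi> s) / (\<phi> s)\<^sup>2 - b ^ k * \<phi> s ^ (k - 1)) \<le> ?C * norm s"
        using order_trans[OF C3(2)[OF s] le(3)] E0 by (simp add: E_def)
      show "\<phi> s \<noteq> 0" using s \<phi>(1,4) by simp
    qed (use k b \<phi>(1) C1 C2 C3 in auto)
    show "norm (s * \<phi> s) < \<epsilon> \<and> (s * \<phi> s) ^ k * H (s * \<phi> s) = s ^ k" if "norm s < \<delta> / 2" for s
      using that \<phi>(1) \<phi>(5,6)[of s] by simp
  qed
qed

subsection \<open>Roots of the reciprocal parameter\<close>

lemma powr_minus_inverse_power:
  fixes t :: real
  assumes "0 < t" and "0 < k"
  shows "(t powr (- 1 / real k)) ^ k = inverse t"
proof -
  have "(t powr (- 1 / real k)) ^ k = (t powr (- 1 / real k)) powr real k"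
    using assms by (intro powr_realpow [symmetric]) simp
  also have "\<dots> = t powr (- 1 / real k * real k)" by (rule powr_powr)
  also have "- 1 / real k * real k = - 1" using assms by simp
  finally show ?thesis using assms by (simp add: powr_minus)
qed

text \<open>For \<open>j = 1, \<dots>, k\<close> these are the \<open>k\<close>-th roots of \<open>1 / \<tau>\<close>.\<close>

definition inv_root :: "nat \<Rightarrow> nat \<Rightarrow> complex \<Rightarrow> complex" where
  "inv_root k j \<tau> = exp (- Complex (ln (norm \<tau>)) (Arg2pi \<tau> + 2 * pi * real j) / of_nat k)"

lemma inv_root_altdef:
  assumes "\<tau> \<noteq> 0"
  shows "inv_root k j \<tau> = of_real (norm \<tau> powr (- 1 / real k)) * cis (- ((Arg2pi \<tau> + 2 * pi * real j) / real k))"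
proof -
  let ?a = "- (ln (norm \<tau>) / real k)" and ?b = "- ((Arg2pi \<tau> + 2 * pi * real j) / real k)"
  have "inv_root k j \<tau> = exp (of_real ?a + \<i> * of_real ?b)"
    unfolding inv_root_def by (rule arg_cong[of _ _ exp]) (simp add: complex_eq_iff)
  also have "\<dots> = of_real (exp ?a) * cis ?b"
    by (simp only: exp_add exp_of_real cis_conv_exp)
  also have "exp ?a = norm \<tau> powr (- 1 / real k)"
    using assms by (simp add: powr_def)
  finally show ?thesis .
qed

lemma norm_inv_root: "\<tau> \<noteq> 0 \<Longrightarrow> norm (inv_root k j \<tau>) = norm \<tau> powr (- 1 / real k)"
  by (simp add: inv_root_altdef norm_mult)

lemma inv_root_power:
  assumes "\<tau> \<noteq> 0" and "0 < k"
  shows "inv_root k j \<tau> ^ k = inverse \<tau>"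
proof -
  let ?x = "norm \<tau> powr (- 1 / real k)" and ?a = "Arg2pi \<tau> + 2 * pi * real j"
  have "?x ^ k = inverse (norm \<tau>)"
    using assms by (intro powr_minus_inverse_power) auto
  moreover have "cis (- (?a / real k)) ^ k = inverse (cis ?a)"
    using assms by (simp only: Complex.DeMoivre cis_inverse) simp
  moreover have "cis ?a = cis (Arg2pi \<tau>)"
    using cis_multiple_2pi[of "real j"] by (simp flip: cis_mult)
  ultimately have "inv_root k j \<tau> ^ k = inverse (of_real (norm \<tau>) * cis (Arg2pi \<tau>))"
    using assms by (simp add: inv_root_altdef power_mult_distrib flip: of_real_power)
  also have "of_real (norm \<tau>) * cis (Arg2pi \<tau>) = \<tau>"
    using Arg2pi_eq[of \<tau>] by (simp add: cis_conv_exp)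
  finally show ?thesis .
qed

lemma inverse_inv_root:
  assumes "\<tau> \<noteq> 0" and "0 < k"
  shows "inverse (inv_root k j \<tau>) = of_real (root k (norm \<tau>)) * cis ((Arg2pi \<tau> + 2 * pi * real j) / real k)"
  using assms by (simp add: inv_root_altdef cis_inverse root_powr_inverse powr_minus divide_inverse)

lemma inv_root_inj:
  assumes "\<tau> \<noteq> 0" and k: "0 < k"
  shows "inj_on (\<lambda>j. inv_root k j \<tau>) {1..k}"
proof (rule inj_onI)
  fix i j assume ij: "i \<in> {1..k}" "j \<in> {1..k}" and eq: "inv_root k i \<tau> = inv_root k j \<tau>"
  obtain n :: int where
    "- Complex (ln (norm \<tau>)) (Arg2pi \<tau> + 2 * pi * real i) / of_nat k
      = - Complex (ln (norm \<tau>)) (Arg2pi \<tau> + 2 * pi * real j) / of_nat k + of_int (2 * n) * of_real pi * \<i>"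
    using eq unfolding inv_root_def exp_eq by auto
  from arg_cong[OF this, of Im]
  have "(Arg2pi \<tau> + 2 * pi * real i) / real k = (Arg2pi \<tau> + 2 * pi * real j) / real k - 2 * (of_int n * pi)"
    by simp
  then have "2 * pi * (real j - real i) = 2 * pi * (of_int n * real k)"
    using k by (simp add: field_simps)
  then have "real_of_int (int j - int i) = real_of_int (n * int k)" by simp
  then have "int j - int i = n * int k" by (simp only: of_int_eq_iff)
  moreover have "\<bar>int j - int i\<bar> < int k" using ij by auto
  ultimately have "n = 0" using k by (auto simp: abs_mult)
  with \<open>int j - int i = n * int k\<close> show "i = j" by simp
qed

text \<open>Counting: the k determinations are distinct k-th roots of \<open>s ^ k\<close>, of which
  there are exactly k.\<close>

lemma inv_root_surj:
  assumes "s \<noteq> 0" and k: "0 < k"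
  shows "\<exists>j\<in>{1..k}. inv_root k j (inverse (s ^ k)) = s"
proof -
  let ?\<tau> = "inverse (s ^ k)" and ?S = "{x. x ^ k = s ^ k}"
  have \<tau>: "?\<tau> \<noteq> 0" using assms by simp
  have fin: "finite ?S" and card: "card ?S = k"
    using card_nth_roots[of "s ^ k" k] finite_nth_roots[OF k] assms by auto
  have sub: "(\<lambda>j. inv_root k j ?\<tau>) ` {1..k} \<subseteq> ?S"
    using inv_root_power[OF \<tau> k] by auto
  have "(\<lambda>j. inv_root k j ?\<tau>) ` {1..k} = ?S"
    using card_subset_eq[OF fin sub] card card_image[OF inv_root_inj[OF \<tau> k]] by simp
  then show ?thesis by (metis (mono_tags, lifting) imageE mem_Collect_eq)
qed

text \<open>This is why the traces become closed curves: one determination sends the circle of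
  parameters to a half-open arc of angle 2 pi / k, and the k arcs fit together to a full
  circle.\<close>

lemma inv_root_sphere:
  assumes t: "0 < t" and k: "0 < k"
  shows "(\<Union>j\<in>{1..k}. inv_root k j ` sphere 0 t) = sphere 0 (t powr (- 1 / real k))"
proof (intro equalityI subsetI)
  fix s :: complex assume s: "s \<in> sphere 0 (t powr (- 1 / real k))"
  then have "s \<noteq> 0" using t by auto
  have "norm s ^ k = inverse t"
    using s powr_minus_inverse_power[OF t k] by simp
  then have "inverse (s ^ k) \<in> sphere 0 t" by (simp add: norm_inverse norm_power)
  then show "s \<in> (\<Union>j\<in>{1..k}. inv_root k j ` sphere 0 t)"
    using inv_root_surj[OF \<open>s \<noteq> 0\<close> k] by force
next
  fix s assume "s \<in> (\<Union>j\<in>{1..k}. inv_root k j ` sphere 0 t)"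
  then obtain j \<tau> where "s = inv_root k j \<tau>" "norm \<tau> = t" by auto
  then show "s \<in> sphere 0 (t powr (- 1 / real k))" using norm_inv_root[of \<tau> k j] t by auto
qed

lemma Arg2pi_polar:
  assumes "0 < r" and "\<theta> \<in> {0..<2 * pi}"
  shows "Arg2pi (of_real r * cis \<theta>) = \<theta>"
  using assms by (intro Arg2pi_unique[of r]) (auto simp: cis_conv_exp)

text \<open>The argument jumps from 2 pi to 0 across the cut while the exponent in \<open>?g\<close>
  continues smoothly; raising \<open>j\<close> by one adds the missing 2 pi.\<close>

lemma tendsto_inv_root_2pi:
  assumes r: "0 < r"
  shows "((\<lambda>\<theta>. inv_root k j (of_real r * cis \<theta>)) \<longlongrightarrow> inv_root k (Suc j) (of_real r)) (at_left (2 * pi))"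
proof -
  let ?g = "\<lambda>\<theta>. exp (- Complex (ln r) (\<theta> + 2 * pi * real j) / of_nat k)"
  have "continuous_on UNIV ?g"
    unfolding Complex_eq by (cases "k = 0") (auto intro!: continuous_intros)
  then have "isCont ?g (2 * pi)" by (simp add: continuous_on_eq_continuous_at)
  then have "(?g \<longlongrightarrow> ?g (2 * pi)) (at_left (2 * pi))"
    unfolding isCont_def by (rule tendsto_mono[OF at_le[OF subset_UNIV]])
  moreover have "?g (2 * pi) = inv_root k (Suc j) (of_real r)"
    using r Arg2pi_of_real[of r] by (simp add: inv_root_def algebra_simps)
  moreover have "\<forall>\<^sub>F \<theta> in at_left (2 * pi). ?g \<theta> = inv_root k j (of_real r * cis \<theta>)"
  proof -
    have "\<forall>\<^sub>F \<theta> in at_left (2 * pi). \<theta> \<in> {0<..<2 * pi}"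
      by (rule eventually_at_left_real) simp
    then show ?thesis
    proof eventually_elim
      case (elim \<theta>)
      have "Arg2pi (of_real r * cis \<theta>) = \<theta>"
        using elim by (intro Arg2pi_polar[OF r]) auto
      then show ?case using r by (simp add: inv_root_def norm_mult)
    qed
  qed
  ultimately show ?thesis using tendsto_cong by force
qed

lemma inv_root_period:
  assumes "0 < k"
  shows "inv_root k (k + j) \<tau> = inv_root k j \<tau>"
  unfolding inv_root_def exp_eq
  by (rule exI[of _ "- 1"]) (use assms in \<open>simp add: complex_eq_iff field_simps\<close>)

text \<open>On the slit neighbourhood of \<open>\<tau>\<close> the chosen branch of the logarithm differs from the principal
  logarithm of \<open>s / \<tau>\<close> by a constant.\<close>

lemma has_field_derivative_inv_root:
  assumes \<tau>: "\<tau> \<noteq> 0" and k: "0 < k"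
  shows "(inv_root k j has_field_derivative - inv_root k j \<tau> / (of_nat k * \<tau>)) (at \<tau> within slit_nbhd \<tau>)"
proof -
  let ?L = "Complex (ln (norm \<tau>)) (Arg2pi \<tau> + 2 * pi * real j)"
  let ?g = "\<lambda>s. exp (- (?L + Ln (s / \<tau>)) / of_nat k)"
  have "(?g has_field_derivative - inv_root k j \<tau> / (of_nat k * \<tau>)) (at \<tau> within slit_nbhd \<tau>)"
    using \<tau> k by (auto intro!: derivative_eq_intros simp: inv_root_def field_simps)
  moreover have "?g s = inv_root k j s" if s: "s \<in> slit_nbhd \<tau>" "dist s \<tau> < norm \<tau>" for s
  proof -
    have "s \<noteq> 0" using s by auto
    define w where "w = Complex (ln (norm s) - ln (norm \<tau>)) (Arg2pi s - Arg2pi \<tau>)"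
    have "w = Complex (ln (norm s)) (Arg2pi s) - Complex (ln (norm \<tau>)) (Arg2pi \<tau>)"
      by (simp add: w_def complex_eq_iff)
    moreover have "exp (Complex (ln (norm z)) (Arg2pi z)) = z" if "z \<noteq> 0" for z
      using that Arg2pi_eq[of z] by (simp add: Complex_eq exp_add exp_of_real)
    ultimately have "exp w = s / \<tau>" using \<tau> \<open>s \<noteq> 0\<close> by (simp add: exp_diff)
    moreover have "\<bar>Im w\<bar> < pi" using s by (simp add: w_def slit_nbhd_def)
    ultimately have "Ln (s / \<tau>) = w"
      using Ln_exp[of w] by (simp add: abs_less_iff)
    then have "?L + Ln (s / \<tau>) = Complex (ln (norm s)) (Arg2pi s + 2 * pi * real j)"
      by (simp add: w_def complex_eq_iff)
    then show ?thesis by (simp add: inv_root_def)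
  qed
  moreover have "\<tau> \<in> slit_nbhd \<tau>" by (simp add: slit_nbhd_def)
  ultimately show ?thesis
    using has_field_derivative_transform_within[of ?g _ \<tau> "slit_nbhd \<tau>" "norm \<tau>"] \<tau> by auto
qed

lemma cis_image_sphere:
  assumes "0 \<le> x" and w: "norm w = 1"
  shows "(\<lambda>\<theta>. of_real x * cis \<theta> * w) ` {0..2 * pi} = sphere 0 x"
proof (intro equalityI subsetI)
  fix s :: complex assume s: "s \<in> sphere 0 x"
  have "w \<noteq> 0" using w by auto
  have "s / w = of_real (norm (s / w)) * cis (Arg2pi (s / w))"
    using Arg2pi_eq[of "s / w"] by (simp add: cis_conv_exp)
  then have "s = of_real x * cis (Arg2pi (s / w)) * w"
    using s w \<open>w \<noteq> 0\<close> by (simp add: norm_divide field_simps)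
  moreover have "Arg2pi (s / w) \<in> {0..2 * pi}" using Arg2pi[of "s / w"] by auto
  ultimately show "s \<in> (\<lambda>\<theta>. of_real x * cis \<theta> * w) ` {0..2 * pi}" by blast
qed (use assms in \<open>auto simp: norm_mult\<close>)

lemma cis_minus_image_sphere:
  assumes "0 \<le> x" and w: "norm w = 1"
  shows "(\<lambda>\<theta>. of_real x * cis (- \<theta>) * w) ` {0..2 * pi} = sphere 0 x"
proof -
  have "(\<lambda>\<theta>. of_real x * cis (- \<theta>) * w) ` {0..2 * pi}
    = cnj ` ((\<lambda>\<theta>. of_real x * cis \<theta> * cnj w) ` {0..2 * pi})"
    by (simp add: image_image cis_cnj)
  also have "\<dots> = cnj ` sphere 0 x" using cis_image_sphere[of x "cnj w"] assms by simp
  also have "\<dots> = sphere 0 x"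
    by (auto intro: image_eqI[where x = "cnj s" for s])
  finally show ?thesis .
qed

lemma tendsto_inv_root_at_infinity:
  assumes k: "0 < k"
  shows "(inv_root k j \<longlongrightarrow> 0) at_infinity"
proof (rule tendsto_norm_zero_cancel)
  have "((\<lambda>t. t powr (- 1 / real k)) \<longlongrightarrow> 0) at_top"
    using k by (intro tendsto_neg_powr filterlim_ident) auto
  then have "((\<lambda>\<tau>::complex. norm \<tau> powr (- 1 / real k)) \<longlongrightarrow> 0) at_infinity"
    by (rule filterlim_compose[OF _ filterlim_norm_at_top])
  moreover have "\<forall>\<^sub>F \<tau> in at_infinity. norm \<tau> powr (- 1 / real k) = norm (inv_root k j \<tau>)"
    unfolding eventually_at_infinity
  proof (intro exI[of _ 1] allI impI)
    fix \<tau> :: complex assume "1 \<le> norm \<tau>"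
    then have "\<tau> \<noteq> 0" by auto
    then show "norm \<tau> powr (- 1 / real k) = norm (inv_root k j \<tau>)" by (rule norm_inv_root[symmetric])
  qed
  ultimately show "((\<lambda>\<tau>. norm (inv_root k j \<tau>)) \<longlongrightarrow> 0) at_infinity"
    by (rule Lim_transform_eventually)
qed

lemma inv_root_image_sphere:
  assumes "0 < t" and "0 < k"
  shows "(\<Union>j\<in>{1..k}. (\<lambda>\<tau>. F (inv_root k j \<tau>)) ` sphere 0 t) = F ` sphere 0 (t powr (- 1 / real k))"
  unfolding inv_root_sphere[OF assms, symmetric] image_UN image_image ..

subsection \<open>Curves traced by a branch\<close>

context branch
begin

lemma branch_nonzero: "norm s < \<delta> \<Longrightarrow> s \<noteq> 0 \<Longrightarrow> s * \<phi> s \<noteq> 0"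
  using nz by simp

lemma branch_injD: "norm s < \<delta> \<Longrightarrow> norm s' < \<delta> \<Longrightarrow> s * \<phi> s = s' * \<phi> s' \<Longrightarrow> s = s'"
  by (rule inj_onD[OF inj]) auto

lemma continuous_on_branch: "continuous_on (ball 0 \<delta>) (\<lambda>s. s * \<phi> s)"
  using holomorphic_on_imp_continuous_on[OF hol] by (intro continuous_intros)

lemma norm_branch_diff:
  assumes s: "norm s < \<delta>"
  shows "norm (s * \<phi> s - s / b) \<le> C * norm s ^ 2"
proof -
  have "s * \<phi> s - s / b = s * (\<phi> s - inverse b)" by (simp add: algebra_simps divide_inverse)
  then have "norm (s * \<phi> s - s / b) = norm s * norm (\<phi> s - inverse b)" by (simp only: norm_mult)
  also have "\<dots> \<le> norm s * (C * norm s)" using bound[OF s] by (intro mult_left_mono) auto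
  finally show ?thesis by (simp add: power2_eq_square mult_ac)
qed

lemma norm_inverse_branch_diff:
  assumes s: "norm s < \<delta>" "s \<noteq> 0"
  shows "norm (inverse (s * \<phi> s) - b * inverse s) \<le> C"
proof -
  have "inverse (s * \<phi> s) - b * inverse s = (inverse (\<phi> s) - b) * inverse s"
    by (simp add: algebra_simps)
  then have "norm (inverse (s * \<phi> s) - b * inverse s) = norm (inverse (\<phi> s) - b) / norm s"
    by (simp only: norm_mult norm_inverse divide_inverse)
  also have "\<dots> \<le> C" using bound_inverse[OF s(1)] s(2) by (simp add: divide_le_eq)
  finally show ?thesis .
qed

text \<open>Turns errors in powers of s into errors in powers of the reciprocal eigenvalue, as
  needed for a remainder stated in terms of the eigenvalue itself.\<close>

lemma norm_le_branch:
  assumes s: "norm s < \<delta>"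
  shows "norm s \<le> (norm b + C * \<delta>) * norm (s * \<phi> s)"
proof -
  have "norm (inverse (\<phi> s)) \<le> norm b + norm (inverse (\<phi> s) - b)"
    using norm_triangle_sub[of "inverse (\<phi> s)" b] by simp
  also have "\<dots> \<le> norm b + C * norm s" using bound_inverse[OF s] by simp
  also have "\<dots> \<le> norm b + C * \<delta>" using s C_nonneg by (auto intro: mult_left_mono)
  finally have *: "norm (inverse (\<phi> s)) \<le> norm b + C * \<delta>" .
  have "norm s = norm (inverse (\<phi> s)) * norm (s * \<phi> s)"
    using nz[OF s] by (simp add: norm_mult norm_inverse)
  also have "\<dots> \<le> (norm b + C * \<delta>) * norm (s * \<phi> s)" by (intro mult_right_mono * norm_ge_zero)
  finally show ?thesis .
qed

text \<open>The unit factor \<open>b / of_real (norm b)\<close> cancels the phase of the leading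
  term s / b, so that the main part of the curve has argument exactly
  \<open>\<theta>\<close>.\<close>

definition curve :: "real \<Rightarrow> real \<Rightarrow> complex" where
  "curve t \<theta> = (\<lambda>s. s * \<phi> s) (of_real (t powr (- 1 / real k)) * cis \<theta> * (b / of_real (norm b)))"

text \<open>Inversion reverses the orientation, hence \<open>cis (- \<theta>)\<close>; the leading
  term b / s then has argument \<open>\<theta>\<close>.\<close>

definition curve_inf :: "real \<Rightarrow> real \<Rightarrow> complex" where
  "curve_inf t \<theta> = (\<lambda>s. inverse (s * \<phi> s)) (of_real (t powr (- 1 / real k)) * cis (- \<theta>) * (b / of_real (norm b)))"

lemma norm_param: "norm (of_real (t powr (- 1 / real k)) * cis \<theta> * (b / of_real (norm b))) = t powr (- 1 / real k)"
  using b_nz by (simp add: norm_mult norm_divide)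

lemma norm_unit: "norm (b / of_real (norm b)) = 1"
  using b_nz by (simp add: norm_divide)

lemma curve_closed:
  assumes "t powr (- 1 / real k) < \<delta>"
  shows "closed_curve (\<lambda>\<theta>. \<zeta> + curve t \<theta>)"
proof -
  have "continuous_on {0..2 * pi} (\<lambda>\<theta>. (\<lambda>s. s * \<phi> s) (of_real (t powr (- 1 / real k)) * cis \<theta> * (b / of_real (norm b))))"
  proof (rule continuous_on_compose2[OF continuous_on_branch])
    show "(\<lambda>\<theta>. of_real (t powr (- 1 / real k)) * cis \<theta> * (b / of_real (norm b))) ` {0..2 * pi} \<subseteq> ball 0 \<delta>"
      unfolding image_subset_iff mem_ball_0 norm_param using assms by blast
  qed (use b_nz in \<open>auto intro!: continuous_intros\<close>)
  then show ?thesis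
    unfolding closed_curve_def curve_def by (auto intro!: continuous_intros)
qed

lemma trace_of_curve: "trace_of (\<lambda>\<theta>. \<zeta> + curve t \<theta>) = (\<lambda>s. \<zeta> + s * \<phi> s) ` sphere 0 (t powr (- 1 / real k))"
  unfolding trace_of_def curve_def cis_image_sphere[OF powr_ge_zero norm_unit, symmetric] image_image ..

lemma curve_asymp:
  assumes t: "t powr (- 1 / real k) < \<delta>"
  shows "norm (curve t \<theta> - of_real (t powr (- 1 / real k) * inverse (norm b)) * cis \<theta>) \<le> C * t powr (- 2 / real k)"
proof -
  let ?s = "of_real (t powr (- 1 / real k)) * cis \<theta> * (b / of_real (norm b))"
  have "?s / b = of_real (t powr (- 1 / real k) * inverse (norm b)) * cis \<theta>"
    using b_nz by (simp add: field_simps)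
  then have "norm (curve t \<theta> - of_real (t powr (- 1 / real k) * inverse (norm b)) * cis \<theta>) \<le> C * (t powr (- 1 / real k))\<^sup>2"
    using norm_branch_diff[of ?s] t unfolding norm_param curve_def by metis
  also have "(t powr (- 1 / real k))\<^sup>2 = t powr (- 2 / real k)"
    by (simp add: power2_eq_square flip: powr_add)
  finally show ?thesis .
qed

lemma curve_inf_closed:
  assumes "t powr (- 1 / real k) < \<delta>" and "0 < t"
  shows "closed_curve (curve_inf t)"
proof -
  have "continuous_on (ball 0 \<delta> - {0}) (\<lambda>s. inverse (s * \<phi> s))"
    using branch_nonzero by (intro continuous_on_inverse continuous_on_subset[OF continuous_on_branch]) auto
  then have "continuous_on {0..2 * pi} (\<lambda>\<theta>. (\<lambda>s. inverse (s * \<phi> s)) (of_real (t powr (- 1 / real k)) * cis (- \<theta>) * (b / of_real (norm b))))"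
  proof (rule continuous_on_compose2)
    have "of_real (t powr (- 1 / real k)) * cis (- \<theta>) * (b / of_real (norm b)) \<noteq> 0" for \<theta>
      using assms(2) b_nz by simp
    then show "(\<lambda>\<theta>. of_real (t powr (- 1 / real k)) * cis (- \<theta>) * (b / of_real (norm b))) ` {0..2 * pi} \<subseteq> ball 0 \<delta> - {0}"
      unfolding image_subset_iff Diff_iff mem_ball_0 norm_param using assms(1) by blast
  qed (use b_nz in \<open>auto intro!: continuous_intros\<close>)
  then show ?thesis
    unfolding closed_curve_def curve_inf_def by (auto simp flip: cis_cnj)
qed

lemma trace_of_curve_inf: "trace_of (curve_inf t) = (\<lambda>s. inverse (s * \<phi> s)) ` sphere 0 (t powr (- 1 / real k))"
  unfolding trace_of_def curve_inf_def cis_minus_image_sphere[OF powr_ge_zero norm_unit, symmetric] image_image ..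

lemma curve_inf_asymp:
  assumes t: "t powr (- 1 / real k) < \<delta>" and "0 < t"
  shows "norm (curve_inf t \<theta> - of_real (t powr (1 / real k) * norm b) * cis \<theta>) \<le> C"
proof -
  let ?s = "of_real (t powr (- 1 / real k)) * cis (- \<theta>) * (b / of_real (norm b))"
  have "b * inverse ?s = of_real (t powr (1 / real k) * norm b) * cis \<theta>"
    using b_nz \<open>0 < t\<close> by (simp add: field_simps powr_minus cis_divide flip: cis_inverse)
  moreover have "norm ?s < \<delta>" "?s \<noteq> 0" using t b_nz \<open>0 < t\<close> unfolding norm_param by auto
  ultimately show ?thesis
    using norm_inverse_branch_diff[of ?s] unfolding curve_inf_def by metis
qed

text \<open>The derivative of \<open>1 / (s \<phi>(s))\<close> along \<open>s = inv_root k j \<tau>\<close>, using \<open>ds/d\<tau> = - s\<^sup>k\<^sup>+\<^sup>1 / k\<close>.\<close>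

definition eig_deriv :: "complex \<Rightarrow> complex" where
  "eig_deriv s = (\<phi> s + s * deriv \<phi> s) / (\<phi> s)\<^sup>2 * s ^ (k - 1) / of_nat k"

lemma has_field_derivative_eig:
  assumes \<tau>: "\<tau> \<noteq> 0" and \<delta>: "norm \<tau> powr (- 1 / real k) < \<delta>"
  shows "((\<lambda>\<tau>. inverse (inv_root k j \<tau> * \<phi> (inv_root k j \<tau>))) has_field_derivative eig_deriv (inv_root k j \<tau>))
    (at \<tau> within slit_nbhd \<tau>)"
proof -
  let ?s = "inv_root k j \<tau>"
  have s: "norm ?s < \<delta>" "?s \<noteq> 0" using norm_inv_root[OF \<tau>] \<delta> by (auto simp: inv_root_def)
  have d\<phi>: "(\<phi> has_field_derivative deriv \<phi> ?s) (at ?s)"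
    using s by (intro holomorphic_derivI[OF hol]) auto
  have "((\<lambda>s. inverse (s * \<phi> s)) has_field_derivative - (\<phi> ?s + ?s * deriv \<phi> ?s) / (?s * \<phi> ?s)\<^sup>2) (at ?s)"
    using s nz[OF s(1)] by (auto intro!: derivative_eq_intros d\<phi> simp: field_simps power2_eq_square)
  from DERIV_chain2[OF this has_field_derivative_inv_root[OF \<tau> k_pos]]
  have "((\<lambda>\<tau>. inverse (inv_root k j \<tau> * \<phi> (inv_root k j \<tau>))) has_field_derivative
    - (\<phi> ?s + ?s * deriv \<phi> ?s) / (?s * \<phi> ?s)\<^sup>2 * (- ?s / (of_nat k * \<tau>))) (at \<tau> within slit_nbhd \<tau>)" .
  \<comment> \<open>Here 1/tau is replaced by the k-th power of the root, which absorbs the one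
    negative power of the root that remains.\<close>
  also have "- (\<phi> ?s + ?s * deriv \<phi> ?s) / (?s * \<phi> ?s)\<^sup>2 * (- ?s / (of_nat k * \<tau>)) = eig_deriv ?s"
  proof -
    have "inverse \<tau> = ?s ^ (k - 1) * ?s"
      using inv_root_power[OF \<tau> k_pos, of j] k_pos by (cases k) (auto simp: mult.commute)
    then have inv: "inverse \<tau> / ?s = ?s ^ (k - 1)" using s(2) by simp
    have "- x / (?s * y)\<^sup>2 * (- ?s / (K * \<tau>)) = x / y\<^sup>2 * (inverse \<tau> / ?s) / K" for x y K
      using s(2) by (simp add: divide_inverse power2_eq_square mult_ac)
    then show ?thesis unfolding eig_deriv_def inv by (simp only:)
  qed
  finally show ?thesis .
qed

text \<open>With lambda = 1 / (s phi(s)) the model b^k / (k lambda^(k-1)) equals b^k phi(s)^(k-1)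
  s^(k-1) / k, so the difference is s^(k-1) / k times the quantity in \<open>bound_deriv\<close>.
  That is of order s^k, and \<open>norm_le_branch\<close> converts it to lambda^(-k).\<close>

lemma norm_eig_deriv_diff:
  assumes s: "norm s < \<delta>" "s \<noteq> 0"
  shows "norm (eig_deriv s - b ^ k / (of_nat k * inverse (s * \<phi> s) ^ (k - 1)))
    \<le> C * (norm b + C * \<delta>) ^ k * norm (inverse (inverse (s * \<phi> s) ^ k))"
proof -
  let ?D = "(\<phi> s + s * deriv \<phi> s) / (\<phi> s)\<^sup>2 - b ^ k * \<phi> s ^ (k - 1)"
  have "b ^ k / (of_nat k * inverse (s * \<phi> s) ^ (k - 1)) = b ^ k * \<phi> s ^ (k - 1) * s ^ (k - 1) / of_nat k"
    by (simp add: divide_inverse power_mult_distrib power_inverse mult_ac)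
  then have "eig_deriv s - b ^ k / (of_nat k * inverse (s * \<phi> s) ^ (k - 1)) = ?D * s ^ (k - 1) / of_nat k"
    by (simp add: eig_deriv_def left_diff_distrib diff_divide_distrib)
  then have "norm (eig_deriv s - b ^ k / (of_nat k * inverse (s * \<phi> s) ^ (k - 1))) = norm ?D * norm s ^ (k - 1) / real k"
    by (simp add: norm_mult norm_divide norm_power)
  also have "\<dots> \<le> norm ?D * norm s ^ (k - 1)"
    using k_pos divide_left_mono[of 1 "real k" "norm ?D * norm s ^ (k - 1)"] by simp
  also have "\<dots> \<le> C * norm s * norm s ^ (k - 1)"
    using bound_deriv[OF s(1)] by (intro mult_right_mono) auto
  also have "\<dots> = C * norm s ^ k" using k_pos by (cases k) auto
  also have "\<dots> \<le> C * ((norm b + C * \<delta>) * norm (s * \<phi> s)) ^ k"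
    using norm_le_branch[OF s(1)] C_nonneg by (intro mult_left_mono power_mono) auto
  also have "\<dots> = C * (norm b + C * \<delta>) ^ k * norm (inverse (inverse (s * \<phi> s) ^ k))"
    by (simp add: power_mult_distrib norm_power norm_mult flip: power_inverse)
  finally show ?thesis .
qed


lemma tendsto_branch_inv_root: "((\<lambda>\<tau>. \<zeta> + inv_root k j \<tau> * \<phi> (inv_root k j \<tau>)) \<longlongrightarrow> \<zeta>) at_infinity"
proof -
  have "isCont (\<lambda>s. s * \<phi> s) 0"
    using continuous_on_branch \<delta>_pos by (simp add: continuous_on_eq_continuous_at)
  then have "((\<lambda>\<tau>. inv_root k j \<tau> * \<phi> (inv_root k j \<tau>)) \<longlongrightarrow> 0 * \<phi> 0) at_infinity"
    by (rule isCont_tendsto_compose[OF _ tendsto_inv_root_at_infinity[OF k_pos]])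
  then show ?thesis using tendsto_add[OF tendsto_const] by fastforce
qed

lemma tendsto_inverse_branch_2pi:
  assumes r: "0 < r" and "r powr (- 1 / real k) < \<delta>"
  shows "((\<lambda>\<theta>. inverse (inv_root k j (of_real r * cis \<theta>) * \<phi> (inv_root k j (of_real r * cis \<theta>))))
    \<longlongrightarrow> inverse (inv_root k (Suc j) (of_real r) * \<phi> (inv_root k (Suc j) (of_real r)))) (at_left (2 * pi))"
proof -
  let ?s = "inv_root k (Suc j) (of_real r)"
  have s: "norm ?s < \<delta>" "?s \<noteq> 0"
    using assms norm_inv_root[of "of_real r" k "Suc j"] by (auto simp: inv_root_def)
  have "isCont (\<lambda>s. s * \<phi> s) ?s"
    using continuous_on_branch s(1) by (simp add: continuous_on_eq_continuous_at)
  then have "isCont (\<lambda>s. inverse (s * \<phi> s)) ?s"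
    using branch_nonzero[OF s] by (rule continuous_at_within_inverse)
  then show ?thesis by (rule isCont_tendsto_compose[OF _ tendsto_inv_root_2pi[OF r]])
qed

text \<open>The root \<open>b\<close> is prescribed with argument \<open>\<theta>k / real k\<close>.
  This makes determination number \<open>j\<close> produce the j-th of the listed directions rather
  than a shifted one.\<close>

lemma inverse_branch_asymp:
  assumes b: "b = of_real (root k rk) * cis (\<theta>k / real k)"
    and \<theta>: "\<theta> \<in> {0..<2 * pi}" and r: "0 < r" "r powr (- 1 / real k) < \<delta>"
  shows "norm (inverse (inv_root k j (of_real r * cis \<theta>) * \<phi> (inv_root k j (of_real r * cis \<theta>)))
    - of_real (root k (r * rk)) * cis (1 / real k * (\<theta> + \<theta>k) + 2 * real j / real k * pi)) \<le> C"
proof -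
  let ?\<tau> = "of_real r * cis \<theta>"
  have \<tau>: "?\<tau> \<noteq> 0" "norm ?\<tau> = r" using r by (auto simp: norm_mult)
  have "b * inverse (inv_root k j ?\<tau>)
    = of_real (root k rk * root k r) * (cis (\<theta>k / real k) * cis ((\<theta> + 2 * pi * real j) / real k))"
    unfolding inverse_inv_root[OF \<tau>(1) k_pos] \<tau>(2) Arg2pi_polar[OF r(1) \<theta>] by (simp add: b)
  also have "root k rk * root k r = root k (r * rk)" by (simp add: real_root_mult mult.commute)
  also have "cis (\<theta>k / real k) * cis ((\<theta> + 2 * pi * real j) / real k)
    = cis (1 / real k * (\<theta> + \<theta>k) + 2 * real j / real k * pi)"
    unfolding cis_mult by (rule arg_cong[of _ _ cis]) (simp add: add_divide_distrib algebra_simps)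
  finally have eq: "b * inverse (inv_root k j ?\<tau>)
    = of_real (root k (r * rk)) * cis (1 / real k * (\<theta> + \<theta>k) + 2 * real j / real k * pi)" .
  have "norm (inv_root k j ?\<tau>) < \<delta>" "inv_root k j ?\<tau> \<noteq> 0"
    using norm_inv_root[OF \<tau>(1)] \<tau>(2) r(2) by (auto simp: inv_root_def)
  from norm_inverse_branch_diff[OF this] show ?thesis unfolding eq .
qed

end

subsection \<open>Roots of a polynomial pencil\<close>

text \<open>Common roots of \<open>m\<close> and \<open>p\<close> are roots of \<open>m - \<tau> p\<close> for every \<open>\<tau>\<close>; they contribute the
  constant functions \<open>\<mu> i\<close>.\<close>

lemma split_common_roots:
  fixes m p :: "complex poly"
  assumes "m \<noteq> 0"
  shows "\<exists>g m' p'. m = g * m' \<and> p = g * p' \<and> lead_coeff g = 1 \<and> (\<forall>z. poly p' z = 0 \<longrightarrow> poly m' z \<noteq> 0)"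
  using assms
proof (induction "degree m" arbitrary: m p rule: less_induct)
  case less
  show ?case
  proof (cases "\<forall>z. poly p z = 0 \<longrightarrow> poly m z \<noteq> 0")
    case True
    then show ?thesis by (intro exI[of _ 1] exI[of _ m] exI[of _ p]) auto
  next
    case False
    then obtain z m1 p1 where eq: "p = [:- z, 1:] * p1" "m = [:- z, 1:] * m1"
      by (auto simp: poly_eq_0_iff_dvd elim!: dvdE)
    have "m1 \<noteq> 0" using less.prems eq by auto
    then have "degree m1 < degree m" using eq(2) by (simp add: degree_mult_eq del: mult_pCons_left)
    from less.hyps[OF this \<open>m1 \<noteq> 0\<close>, of p1] obtain g m' p' where
      g: "m1 = g * m'" "p1 = g * p'" "lead_coeff g = 1" "\<forall>z. poly p' z = 0 \<longrightarrow> poly m' z \<noteq> 0"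
      by blast
    have "lead_coeff ([:- z, 1:] * g) = 1" unfolding lead_coeff_mult using g(3) by simp
    then show ?thesis
      using g eq by (intro exI[of _ "[:- z, 1:] * g"] exI[of _ m'] exI[of _ p']) (simp only: mult.assoc simp_thms)
  qed
qed

lemma monic_poly_factorization:
  fixes g :: "complex poly"
  assumes "lead_coeff g = 1"
  obtains \<gamma> where "g = (\<Prod>i<degree g. [:- \<gamma> i, 1:])"
proof -
  obtain xs where xs: "mset xs = proots g" using ex_mset by blast
  have "g = (\<Prod>x\<in>#mset xs. [:- x, 1:])"
    using complex_poly_decompose_multiset[of g] assms xs by simp
  also have "\<dots> = (\<Prod>x\<leftarrow>xs. [:- x, 1:])"
    by (simp flip: mset_map add: prod_mset_prod_list)
  also have "\<dots> = (\<Prod>i<length xs. [:- (xs ! i), 1:])"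
    by (simp add: prod.list_conv_set_nth atLeast0LessThan)
  finally have *: "g = (\<Prod>i<length xs. [:- (xs ! i), 1:])" .
  have "degree g = length xs" by (subst *) (simp add: degree_prod_sum_eq)
  then show ?thesis using * that[of "\<lambda>i. xs ! i"] by simp
qed

lemma prod_lessThan_add:
  fixes f :: "nat \<Rightarrow> 'a::comm_monoid_mult"
  shows "(\<Prod>i<a + b. f i) = (\<Prod>i<a. f i) * (\<Prod>i<b. f (a + i))"
  by (induction b) (simp_all add: mult_ac)

text \<open>If the two monic polynomials differed, their difference would have smaller degree but
  still all the distinct values \<open>f i\<close> as zeros. Injectivity replaces any discussion of
  multiplicities.\<close>

lemma monic_eq_prod_roots:
  fixes P :: "complex poly"
  assumes P: "lead_coeff P = 1" and I: "finite I" "card I = degree P" and f: "inj_on f I"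
    and root: "\<And>i. i \<in> I \<Longrightarrow> poly P (f i) = 0"
  shows "P = (\<Prod>i\<in>I. [:- f i, 1:])"
proof (rule ccontr)
  let ?Q = "\<Prod>i\<in>I. [:- f i, 1:]"
  assume "P \<noteq> ?Q"
  then have ne: "P - ?Q \<noteq> 0" by simp
  have degQ: "degree ?Q = degree P" using I by (subst degree_prod_sum_eq) auto
  have lcQ: "lead_coeff ?Q = 1" unfolding lead_coeff_prod by simp
  have "f ` I \<subseteq> {x. poly (P - ?Q) x = 0}" using root I(1) by (auto simp: poly_prod)
  then have "card (f ` I) \<le> degree (P - ?Q)"
    by (rule order_trans[OF card_mono[OF poly_roots_finite[OF ne]] card_poly_roots_bound[OF ne]])
  then have "degree P \<le> degree (P - ?Q)" using card_image[OF f] I(2) by simp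
  moreover have "degree (P - ?Q) \<le> degree P" using degQ degree_diff_le_max[of P ?Q] by simp
  ultimately have deg: "degree (P - ?Q) = degree P" by (rule antisym[rotated])
  have "coeff (P - ?Q) (degree (P - ?Q)) = 0"
    using P lcQ degQ by (subst deg) simp
  then show False using ne by (simp only: leading_coeff_0_iff)
qed

lemma finite_points_separated:
  assumes "finite (X :: complex set)"
  obtains \<epsilon> where "0 < \<epsilon>" "\<And>x y. x \<in> X \<Longrightarrow> y \<in> X \<Longrightarrow> x \<noteq> y \<Longrightarrow> 2 * \<epsilon> \<le> dist x y"
proof -
  \<comment> \<open>The inserted 1 keeps the set nonempty when there are no two distinct points.
    Halving its minimum makes the open discs of radius \<open>\<epsilon>\<close> disjoint.\<close>
  let ?S = "insert 1 ((\<lambda>(x, y). dist x y) ` {(x, y) \<in> X \<times> X. x \<noteq> y})"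
  have fin: "finite ?S" using assms by (auto intro: finite_subset[of _ "X \<times> X"])
  have pos: "0 < Min ?S" using fin by (subst Min_gr_iff) auto
  have le: "Min ?S \<le> dist x y" if "x \<in> X" "y \<in> X" "x \<noteq> y" for x y
    using that by (intro Min_le fin) auto
  show ?thesis using that[of "Min ?S / 2"] pos le by simp
qed

lemma sum_order_eq_degree:
  assumes "p \<noteq> (0 :: complex poly)"
  shows "(\<Sum>z | poly p z = 0. order z p) = degree p"
proof -
  have "degree p = degree (\<Prod>z | poly p z = 0. [:- z, 1:] ^ order z p)"
    using assms by (subst (1) complex_poly_decompose[of p, symmetric]) simp
  also have "\<dots> = (\<Sum>z | poly p z = 0. order z p)"
    by (subst degree_prod_sum_eq) (auto simp: degree_power_eq)
  finally show ?thesis ..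
qed

text \<open>Apply \<open>branch_exists\<close> to H(x) = h(zeta + x) / m(zeta + x), where h is the
  cofactor of the full power of X - zeta in \<open>p\<close>; the equation solved is then p / m =
  s^k. Any k-th root of H(0) will do for \<open>\<beta>\<close>: the later asymptotics use only its
  modulus, which the second conjunct determines.\<close>

lemma finite_root_branch:
  fixes m p :: "complex poly"
  assumes p: "p \<noteq> 0" and \<zeta>: "poly p \<zeta> = 0" and \<epsilon>: "0 < \<epsilon>"
    and m: "\<And>x. norm x < \<epsilon> \<Longrightarrow> poly m (\<zeta> + x) \<noteq> 0"
  shows "\<exists>\<beta> \<phi> \<delta> C. branch (order \<zeta> p) \<beta> \<phi> \<delta> C \<and>
    (\<forall>h. p = [:- \<zeta>, 1:] ^ order \<zeta> p * h \<longrightarrow> \<beta> ^ order \<zeta> p * poly m \<zeta> = poly h \<zeta>) \<and>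
    (\<forall>s. norm s < \<delta> \<longrightarrow> norm (s * \<phi> s) < \<epsilon> \<and>
      poly p (\<zeta> + s * \<phi> s) = s ^ order \<zeta> p * poly m (\<zeta> + s * \<phi> s))"
proof -
  let ?k = "order \<zeta> p"
  have k: "0 < ?k" using p \<zeta> order_root by auto
  obtain h where h: "p = [:- \<zeta>, 1:] ^ ?k * h" "\<not> [:- \<zeta>, 1:] dvd h"
    using order_decomp[OF p] by blast
  have hnz: "poly h \<zeta> \<noteq> 0" using h(2) by (simp add: poly_eq_0_iff_dvd)
  define H where "H x = poly h (\<zeta> + x) / poly m (\<zeta> + x)" for x
  have m0: "poly m \<zeta> \<noteq> 0" using m[of 0] \<epsilon> by simp
  define \<beta> where "\<beta> = exp (Ln (H 0) / of_nat ?k)"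
  have \<beta>: "H 0 = \<beta> ^ ?k" "\<beta> \<noteq> 0"
    using hnz m0 k by (auto simp: \<beta>_def H_def simp flip: exp_of_nat_mult)
  have "H holomorphic_on ball 0 \<epsilon>"
    unfolding H_def using m by (auto intro!: holomorphic_intros)
  from branch_exists[OF \<epsilon> this k \<beta>] obtain \<phi> \<delta> C where br: "branch ?k \<beta> \<phi> \<delta> C"
    "\<And>s. norm s < \<delta> \<Longrightarrow> norm (s * \<phi> s) < \<epsilon> \<and> (s * \<phi> s) ^ ?k * H (s * \<phi> s) = s ^ ?k"
    by metis
  have "poly p (\<zeta> + s * \<phi> s) = s ^ ?k * poly m (\<zeta> + s * \<phi> s)" if s: "norm s < \<delta>" for s
  proof -
    have "poly p (\<zeta> + s * \<phi> s) = (s * \<phi> s) ^ ?k * poly h (\<zeta> + s * \<phi> s)"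
      by (subst h(1)) simp
    also have "\<dots> = (s * \<phi> s) ^ ?k * H (s * \<phi> s) * poly m (\<zeta> + s * \<phi> s)"
    proof -
      have "poly m (\<zeta> + s * \<phi> s) \<noteq> 0" using m br(2)[OF s] by blast
      then show ?thesis by (simp add: H_def)
    qed
    finally show ?thesis using br(2)[OF s] by simp
  qed
  moreover have "\<beta> ^ ?k * poly m \<zeta> = poly h' \<zeta>" if "p = [:- \<zeta>, 1:] ^ ?k * h'" for h'
  proof -
    have "[:- \<zeta>, 1:] ^ ?k * h' = [:- \<zeta>, 1:] ^ ?k * h" using that h(1) by metis
    then have "h' = h" by simp
    then show ?thesis using \<beta>(1) m0 by (simp add: H_def field_simps)
  qed
  ultimately show ?thesis using br by blast
qed

text \<open>The substitution z = 1/x turns p / m into x^K times the quotient of the reflected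
  polynomials: the degree gap \<open>K\<close> is the order of the zero at infinity. At x = 0 that
  quotient is the ratio of leading coefficients, hence \<open>b ^ K\<close> with \<open>b\<close>
  prescribed.\<close>

lemma infinite_root_branch:
  fixes m p :: "complex poly"
  assumes m: "lead_coeff m = 1" and K: "0 < K" and deg: "degree p + K = degree m"
    and lc: "lead_coeff p = b ^ K" and b: "b \<noteq> 0" and M: "0 < M" "\<And>z. M < norm z \<Longrightarrow> poly m z \<noteq> 0"
  shows "\<exists>\<phi> \<delta> C. branch K b \<phi> \<delta> C \<and>
    (\<forall>s. norm s < \<delta> \<and> s \<noteq> 0 \<longrightarrow> M < norm (inverse (s * \<phi> s)) \<and>
      poly p (inverse (s * \<phi> s)) = s ^ K * poly m (inverse (s * \<phi> s)))"
proof -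
  define H where "H x = poly (reflect_poly p) x / poly (reflect_poly m) x" for x
  have M': "M < norm (inverse x)" if "norm x < inverse M" "x \<noteq> 0" for x :: complex
    using less_imp_inverse_less[OF that(1)] that(2) M(1) by (simp add: norm_inverse)
  have rm: "poly (reflect_poly m) x \<noteq> 0" if "norm x < inverse M" for x
    using that m M(2)[OF M'[OF that]] by (cases "x = 0") (auto simp: poly_reflect_poly_nz)
  have "H holomorphic_on ball 0 (inverse M)"
    unfolding H_def using rm by (auto intro!: holomorphic_intros)
  moreover have "H 0 = b ^ K" using m lc by (simp add: H_def)
  moreover have "0 < inverse M" using M by simp
  ultimately obtain \<phi> \<delta> C where br: "branch K b \<phi> \<delta> C"
    "\<And>s. norm s < \<delta> \<Longrightarrow> norm (s * \<phi> s) < inverse M \<and> (s * \<phi> s) ^ K * H (s * \<phi> s) = s ^ K"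
    using branch_exists[of "inverse M" H K b] K b by metis
  have "M < norm (inverse (s * \<phi> s)) \<and> poly p (inverse (s * \<phi> s)) = s ^ K * poly m (inverse (s * \<phi> s))"
    if s: "norm s < \<delta>" "s \<noteq> 0" for s
  proof -
    define x where "x = s * \<phi> s"
    have x: "x \<noteq> 0" "norm x < inverse M" "x ^ K * H x = s ^ K"
      using branch.branch_nonzero[OF br(1) s] br(2)[OF s(1)] by (auto simp: x_def)
    have mx: "poly m (inverse x) \<noteq> 0" using M(2) M' x by blast
    have "s ^ K = x ^ K * (x ^ degree p * poly p (inverse x)) / (x ^ degree m * poly m (inverse x))"
      using x by (simp add: H_def poly_reflect_poly_nz)
    also have "\<dots> = poly p (inverse x) / poly m (inverse x)"
      using x(1) by (simp flip: deg add: power_add)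
    finally have "poly p (inverse x) = s ^ K * poly m (inverse x)" using mx by simp
    then show ?thesis using M'[OF x(2,1)] by (simp add: x_def)
  qed
  then show ?thesis using br(1) by blast
qed

text \<open>The listed branches are \<open>degree m\<close> distinct roots of the monic polynomial \<open>m - \<tau> p\<close>, so there
  are no others.\<close>

lemma pencil_branches:
  fixes m p :: "complex poly"
  assumes m: "lead_coeff m = 1" and K: "0 < K" and deg: "degree p + K = degree m"
    and lc: "lead_coeff p = b ^ K" and b: "b \<noteq> 0"
    and cop: "\<And>z. poly p z = 0 \<Longrightarrow> poly m z \<noteq> 0"
  obtains R \<beta> \<phi> \<delta> C \<phi>0 \<delta>0 C0 where
    "0 < R" "branch K b \<phi>0 \<delta>0 C0"
    "\<And>\<zeta>. poly p \<zeta> = 0 \<Longrightarrow> branch (order \<zeta> p) (\<beta> \<zeta>) (\<phi> \<zeta>) (\<delta> \<zeta>) (C \<zeta>)"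
    "\<And>\<zeta> h. poly p \<zeta> = 0 \<Longrightarrow> p = [:- \<zeta>, 1:] ^ order \<zeta> p * h \<Longrightarrow> \<beta> \<zeta> ^ order \<zeta> p * poly m \<zeta> = poly h \<zeta>"
    "\<And>t. R < t \<Longrightarrow> t powr (- 1 / real K) < \<delta>0"
    "\<And>t \<zeta>. R < t \<Longrightarrow> poly p \<zeta> = 0 \<Longrightarrow> t powr (- 1 / real (order \<zeta> p)) < \<delta> \<zeta>"
    "\<And>s \<zeta> s'. norm s < \<delta>0 \<Longrightarrow> s \<noteq> 0 \<Longrightarrow> poly p \<zeta> = 0 \<Longrightarrow> norm s' < \<delta> \<zeta> \<Longrightarrow>
      inverse (s * \<phi>0 s) \<noteq> \<zeta> + s' * \<phi> \<zeta> s'"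
    "\<And>\<zeta> s \<zeta>' s'. poly p \<zeta> = 0 \<Longrightarrow> norm s < \<delta> \<zeta> \<Longrightarrow> poly p \<zeta>' = 0 \<Longrightarrow> norm s' < \<delta> \<zeta>' \<Longrightarrow>
      \<zeta> + s * \<phi> \<zeta> s = \<zeta>' + s' * \<phi> \<zeta>' s' \<Longrightarrow> \<zeta> = \<zeta>'"
    "\<And>\<tau>. R < norm \<tau> \<Longrightarrow> m - Polynomial.smult \<tau> p =
      (\<Prod>j\<in>{1..K}. [:- inverse (inv_root K j \<tau> * \<phi>0 (inv_root K j \<tau>)), 1:]) *
      (\<Prod>\<zeta> | poly p \<zeta> = 0. \<Prod>j\<in>{1..order \<zeta> p}.
        [:- (\<zeta> + inv_root (order \<zeta> p) j \<tau> * \<phi> \<zeta> (inv_root (order \<zeta> p) j \<tau>)), 1:])"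
proof -
  have p: "p \<noteq> 0" using lc b by auto
  have m0: "m \<noteq> 0" using m by auto
  let ?Z = "{z. poly p z = 0}" and ?Y = "{z. poly m z = 0}"
  have fin: "finite (?Z \<union> ?Y)" and finZ: "finite ?Z"
    using poly_roots_finite[OF p] poly_roots_finite[OF m0] by auto
  \<comment> \<open>Zeros of \<open>m\<close> are included, so that each disc of radius
    \<open>\<epsilon>\<close> about a zero of \<open>p\<close> is free of them and the quotient is
    holomorphic there.\<close>
  obtain \<epsilon> where \<epsilon>: "0 < \<epsilon>" "\<And>x y. x \<in> ?Z \<union> ?Y \<Longrightarrow> y \<in> ?Z \<union> ?Y \<Longrightarrow> x \<noteq> y \<Longrightarrow> 2 * \<epsilon> \<le> dist x y"
    using finite_points_separated[OF fin] by metis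
  have mnz: "poly m (\<zeta> + x) \<noteq> 0" if "poly p \<zeta> = 0" "norm x < \<epsilon>" for \<zeta> x
  proof
    assume y: "poly m (\<zeta> + x) = 0"
    then have "2 * \<epsilon> \<le> dist \<zeta> (\<zeta> + x)" using that(1) cop by (intro \<epsilon>(2)) auto
    then show False using that(2) \<epsilon>(1) by (simp add: dist_norm)
  qed
  \<comment> \<open>The four objects of a branch are packed into one tuple so that a single
    application of \<open>bchoice\<close> selects them for every zero.\<close>
  define good where "good \<zeta> q = (case q of (\<beta>, \<phi>, \<delta>, C) \<Rightarrow> branch (order \<zeta> p) \<beta> \<phi> \<delta> C \<and>
    (\<forall>h. p = [:- \<zeta>, 1:] ^ order \<zeta> p * h \<longrightarrow> \<beta> ^ order \<zeta> p * poly m \<zeta> = poly h \<zeta>) \<and>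
    (\<forall>s. norm s < \<delta> \<longrightarrow> norm (s * \<phi> s) < \<epsilon> \<and>
      poly p (\<zeta> + s * \<phi> s) = s ^ order \<zeta> p * poly m (\<zeta> + s * \<phi> s)))" for \<zeta> q
  have "\<forall>\<zeta>\<in>?Z. \<exists>q. good \<zeta> q"
    using finite_root_branch[OF p _ \<epsilon>(1) mnz] unfolding good_def by simp
  then obtain F where F: "\<forall>\<zeta>\<in>?Z. good \<zeta> (F \<zeta>)" using bchoice[of ?Z good] by blast
  define \<beta> where "\<beta> \<zeta> = fst (F \<zeta>)" for \<zeta>
  define \<phi> where "\<phi> \<zeta> = fst (snd (F \<zeta>))" for \<zeta>
  define \<delta> where "\<delta> \<zeta> = fst (snd (snd (F \<zeta>)))" for \<zeta>
  define C where "C \<zeta> = snd (snd (snd (F \<zeta>)))" for \<zeta>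
  have "good \<zeta> (\<beta> \<zeta>, \<phi> \<zeta>, \<delta> \<zeta>, C \<zeta>)" if "poly p \<zeta> = 0" for \<zeta>
    using F that by (simp add: \<beta>_def \<phi>_def \<delta>_def C_def)
  then have br: "branch (order \<zeta> p) (\<beta> \<zeta>) (\<phi> \<zeta>) (\<delta> \<zeta>) (C \<zeta>)"
    and h: "\<And>h. p = [:- \<zeta>, 1:] ^ order \<zeta> p * h \<Longrightarrow> \<beta> \<zeta> ^ order \<zeta> p * poly m \<zeta> = poly h \<zeta>"
    and near: "\<And>s. norm s < \<delta> \<zeta> \<Longrightarrow> norm (s * \<phi> \<zeta> s) < \<epsilon>"
    and sol: "\<And>s. norm s < \<delta> \<zeta> \<Longrightarrow> poly p (\<zeta> + s * \<phi> \<zeta> s) = s ^ order \<zeta> p * poly m (\<zeta> + s * \<phi> \<zeta> s)"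
    if "poly p \<zeta> = 0" for \<zeta>
    using that unfolding good_def by blast+
  \<comment> \<open>All zeros of \<open>p\<close> and \<open>m\<close> have modulus at most
    \<open>B\<close>. The branch at infinity is kept beyond \<open>B + \<epsilon>\<close>, outside
    every disc in which a finite branch moves.\<close>
  obtain B where B: "0 < B" "\<forall>z\<in>?Z \<union> ?Y. norm z \<le> B"
    using finite_imp_bounded[OF fin] unfolding bounded_pos by blast
  obtain \<phi>0 \<delta>0 C0 where br0: "branch K b \<phi>0 \<delta>0 C0"
    and far: "\<And>s. norm s < \<delta>0 \<Longrightarrow> s \<noteq> 0 \<Longrightarrow> B + \<epsilon> < norm (inverse (s * \<phi>0 s))"
    and sol0: "\<And>s. norm s < \<delta>0 \<Longrightarrow> s \<noteq> 0 \<Longrightarrow> poly p (inverse (s * \<phi>0 s)) = s ^ K * poly m (inverse (s * \<phi>0 s))"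
  proof -
    have "\<And>z. B + \<epsilon> < norm z \<Longrightarrow> poly m z \<noteq> 0" using B \<epsilon>(1) by force
    then show ?thesis
      using infinite_root_branch[OF m K deg lc b, of "B + \<epsilon>"] B(1) \<epsilon>(1) that by force
  qed
  have small: "\<forall>\<^sub>F t in at_top. t powr (- 1 / real k) < d" if "0 < k" "0 < d" for k :: nat and d :: real
    using that by (intro order_tendstoD(2)[OF tendsto_neg_powr[OF _ filterlim_ident]]) auto
  have "\<forall>\<^sub>F t in at_top. t powr (- 1 / real K) < \<delta>0 \<and> (\<forall>\<zeta>\<in>?Z. t powr (- 1 / real (order \<zeta> p)) < \<delta> \<zeta>)"
    using K finZ br0 br by (intro eventually_conj eventually_ball_finite ballI small)
      (auto intro: branch.\<delta>_pos branch.k_pos)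
  then obtain N where N: "\<And>t. N \<le> t \<Longrightarrow> t powr (- 1 / real K) < \<delta>0"
    "\<And>t \<zeta>. N \<le> t \<Longrightarrow> poly p \<zeta> = 0 \<Longrightarrow> t powr (- 1 / real (order \<zeta> p)) < \<delta> \<zeta>"
    unfolding eventually_at_top_linorder by blast
  \<comment> \<open>The 1 guarantees a nonzero parameter beyond the threshold; \<open>N\<close> puts
    all the roots into the discs of their branches.\<close>
  let ?R = "max 1 N"
  have sep0: "inverse (s * \<phi>0 s) \<noteq> \<zeta> + s' * \<phi> \<zeta> s'"
    if "norm s < \<delta>0" "s \<noteq> 0" "poly p \<zeta> = 0" "norm s' < \<delta> \<zeta>" for s \<zeta> s'
  proof
    assume "inverse (s * \<phi>0 s) = \<zeta> + s' * \<phi> \<zeta> s'"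
    then have "B + \<epsilon> < norm (\<zeta> + s' * \<phi> \<zeta> s')" using far[OF that(1,2)] by simp
    also have "\<dots> \<le> norm \<zeta> + norm (s' * \<phi> \<zeta> s')" by (rule norm_triangle_ineq)
    also have "\<dots> \<le> B + \<epsilon>"
    proof -
      have "norm \<zeta> \<le> B" using B(2) that(3) by blast
      then show ?thesis using near[OF that(3,4)] by linarith
    qed
    finally show False by simp
  qed
  have sep: "\<zeta> = \<zeta>'" if "poly p \<zeta> = 0" "norm s < \<delta> \<zeta>" "poly p \<zeta>' = 0" "norm s' < \<delta> \<zeta>'"
    and eq: "\<zeta> + s * \<phi> \<zeta> s = \<zeta>' + s' * \<phi> \<zeta>' s'" for \<zeta> s \<zeta>' s'
  proof (rule ccontr)
    assume "\<zeta> \<noteq> \<zeta>'"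
    then have "2 * \<epsilon> \<le> dist \<zeta> \<zeta>'" using that by (intro \<epsilon>(2)) auto
    also have "\<dots> = norm (s' * \<phi> \<zeta>' s' - s * \<phi> \<zeta> s)"
      using eq unfolding dist_norm by (metis add_diff_cancel_left' add_diff_eq diff_diff_eq2 norm_minus_commute)
    also have "\<dots> \<le> norm (s' * \<phi> \<zeta>' s') + norm (s * \<phi> \<zeta> s)" by (rule norm_triangle_ineq4)
    also have "\<dots> < \<epsilon> + \<epsilon>" using near that by (intro add_strict_mono) auto
    finally show False by simp
  qed
  have prod: "m - Polynomial.smult \<tau> p =
      (\<Prod>j\<in>{1..K}. [:- inverse (inv_root K j \<tau> * \<phi>0 (inv_root K j \<tau>)), 1:]) *
      (\<Prod>\<zeta>\<in>?Z. \<Prod>j\<in>{1..order \<zeta> p}.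
        [:- (\<zeta> + inv_root (order \<zeta> p) j \<tau> * \<phi> \<zeta> (inv_root (order \<zeta> p) j \<tau>)), 1:])"
    if \<tau>: "?R < norm \<tau>" for \<tau>
  proof -
    let ?P = "m - Polynomial.smult \<tau> p"
    have \<tau>0: "\<tau> \<noteq> 0" using \<tau> by auto
    \<comment> \<open>Its cardinality is \<open>K\<close> plus the sum of the orders of the zeros of
      \<open>p\<close>, that is \<open>K + degree p\<close>, the degree of the pencil.\<close>
    let ?I = "{1..K} <+> Sigma ?Z (\<lambda>\<zeta>. {1..order \<zeta> p})"
    define f0 where "f0 j = inverse (inv_root K j \<tau> * \<phi>0 (inv_root K j \<tau>))" for j
    define f1 where "f1 = (\<lambda>(\<zeta>, j). \<zeta> + inv_root (order \<zeta> p) j \<tau> * \<phi> \<zeta> (inv_root (order \<zeta> p) j \<tau>))"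
    have s0: "norm (inv_root K j \<tau>) < \<delta>0" "inv_root K j \<tau> \<noteq> 0" for j
      using norm_inv_root[OF \<tau>0] N(1) \<tau> by (auto simp: inv_root_def)
    have s1: "norm (inv_root (order \<zeta> p) j \<tau>) < \<delta> \<zeta>" if "poly p \<zeta> = 0" for \<zeta> j
      using norm_inv_root[OF \<tau>0] N(2)[OF _ that] \<tau> by simp
    have less: "degree (Polynomial.smult \<tau> p) < degree m" using \<tau>0 deg K by simp
    then have deg1: "degree ?P = degree m"
      using degree_add_eq_left[of "- Polynomial.smult \<tau> p" m] by simp
    then have "lead_coeff ?P = 1"
      unfolding deg1 using m coeff_eq_0[OF less] by simp
    note degP = deg1 this
    have "?P = (\<Prod>i\<in>?I. [:- case_sum f0 f1 i, 1:])"
    proof (rule monic_eq_prod_roots[OF degP(2)])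
      show "finite ?I" using finZ by auto
      have "card ?I = K + (\<Sum>\<zeta>\<in>?Z. order \<zeta> p)"
        using finZ by (simp add: card_Plus)
      then show "card ?I = degree ?P" using sum_order_eq_degree[OF p] deg degP by simp
      show "inj_on (case_sum f0 f1) ?I"
      proof (rule inj_onI)
        have i0: "i = j" if "f0 i = f0 j" "i \<in> {1..K}" "j \<in> {1..K}" for i j
        proof -
          have "inv_root K i \<tau> * \<phi>0 (inv_root K i \<tau>) = inv_root K j \<tau> * \<phi>0 (inv_root K j \<tau>)"
            using that(1) by (simp only: f0_def inverse_eq_iff_eq)
          then have "inv_root K i \<tau> = inv_root K j \<tau>" by (rule branch.branch_injD[OF br0 s0(1) s0(1)])
          then show ?thesis using inj_onD[OF inv_root_inj[OF \<tau>0 K]] that(2,3) by blast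
        qed
        have i1: "x = y" if "f1 x = f1 y" "x \<in> Sigma ?Z (\<lambda>\<zeta>. {1..order \<zeta> p})" "y \<in> Sigma ?Z (\<lambda>\<zeta>. {1..order \<zeta> p})" for x y
        proof -
          obtain \<zeta> i \<zeta>' j where xy: "x = (\<zeta>, i)" "y = (\<zeta>', j)" by (cases x, cases y)
          have z: "poly p \<zeta> = 0" "poly p \<zeta>' = 0" "i \<in> {1..order \<zeta> p}" "j \<in> {1..order \<zeta>' p}"
            using that xy by auto
          have "\<zeta> = \<zeta>'"
            using that(1) sep[OF z(1) s1[OF z(1)] z(2) s1[OF z(2)]] by (simp add: f1_def xy)
          moreover from this have "inv_root (order \<zeta> p) i \<tau> = inv_root (order \<zeta> p) j \<tau>"
            using that(1) branch.branch_injD[OF br[OF z(1)] s1[OF z(1)] s1[OF z(1)]] by (simp add: f1_def xy)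
          ultimately show ?thesis
            using inj_onD[OF inv_root_inj[OF \<tau>0 branch.k_pos[OF br[OF z(1)]]]] z xy by blast
        qed
        have i01: "f0 i \<noteq> f1 x" if "x \<in> Sigma ?Z (\<lambda>\<zeta>. {1..order \<zeta> p})" for i x
          using that sep0[OF s0] s1 by (auto simp: f0_def f1_def)
        fix x y assume xy: "x \<in> ?I" "y \<in> ?I" "case_sum f0 f1 x = case_sum f0 f1 y"
        show "x = y"
        proof (cases x)
          case x: (Inl i)
          show ?thesis
          proof (cases y)
            case (Inl j)
            then show ?thesis using xy x i0[of i j] by auto
          next
            case (Inr w)
            then show ?thesis using xy x i01[of w i] by auto
          qed
        next
          case x: (Inr w)
          show ?thesis
          proof (cases y)
            case (Inl j)
            then show ?thesis using xy x i01[of w j] by auto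
          next
            case (Inr w')
            then show ?thesis using xy x i1[of w w'] by auto
          qed
        qed
      qed
      fix i assume i: "i \<in> ?I"
      have *: "poly ?P z = 0" if "poly p z = s ^ k * poly m z" "s ^ k = inverse \<tau>" for z s k
        using that \<tau>0 by simp
      show "poly ?P (case_sum f0 f1 i) = 0"
      proof (cases i)
        case (Inl j)
        then show ?thesis using *[OF sol0[OF s0] inv_root_power[OF \<tau>0 K]] by (simp add: f0_def)
      next
        case (Inr x)
        obtain \<zeta> j where x: "x = (\<zeta>, j)" "poly p \<zeta> = 0" using i Inr by auto
        show ?thesis
          using *[OF sol[OF x(2) s1[OF x(2)]] inv_root_power[OF \<tau>0 branch.k_pos[OF br[OF x(2)]]]]
          by (simp add: f1_def x Inr)
      qed
    qed
    also have "\<dots> = (\<Prod>j\<in>{1..K}. [:- f0 j, 1:]) * (\<Prod>x\<in>Sigma ?Z (\<lambda>\<zeta>. {1..order \<zeta> p}). [:- f1 x, 1:])"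
      using finZ by (subst prod.Plus) auto
    also have "(\<Prod>x\<in>Sigma ?Z (\<lambda>\<zeta>. {1..order \<zeta> p}). [:- f1 x, 1:])
      = (\<Prod>\<zeta>\<in>?Z. \<Prod>j\<in>{1..order \<zeta> p}. [:- f1 (\<zeta>, j), 1:])"
      using finZ by (subst prod.Sigma) auto
    finally show ?thesis by (simp only: f0_def f1_def prod.case)
  qed
  show ?thesis
  proof (rule that[of ?R \<phi>0 \<delta>0 C0 \<beta> \<phi> \<delta> C])
    show "t powr (- 1 / real K) < \<delta>0" if "?R < t" for t using N(1) that by simp
    show "t powr (- 1 / real (order \<zeta> p)) < \<delta> \<zeta>" if "?R < t" "poly p \<zeta> = 0" for t \<zeta>
      using N(2) that by simp
  qed (use br0 br h sep0 sep prod in \<open>simp_all\<close>)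
qed

subsection \<open>Eigenvalues of rank-one perturbations\<close>

text \<open>Multiplicities are recorded by letting products of linear factors divide the
  characteristic polynomial, since the spectrum as a set would lose them. The functions
  \<open>eig j\<close> are numbered by determinations of a root cut along the positive axis, hence
  derivatives within \<open>slit_nbhd\<close> and the cyclic shift. The denominator
  \<open>of_nat (\<kappa> + 1) * eig j \<tau> ^ \<kappa>\<close> is what differentiating the leading
  behaviour (c tau)^(1/(kappa + 1)) gives. The last part takes the zeros off the spectrum, where
  \<open>resolvent\<close> is an inverse, and adds \<open>frozen_eigenvalues A\<close>, which do not
  move with the parameter.\<close>

theorem theorem17:
  fixes A :: "complex mat" and u v :: "complex vec" and n l \<kappa> :: nat
    and r\<^sub>\<kappa> \<theta>\<^sub>\<kappa> :: real
  assumes "A \<in> carrier_mat n n" and "u \<in> carrier_vec n" and "v \<in> carrier_vec n"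
    and "l = degree (min_poly A)" and "\<kappa> < l"
    and "\<forall>i<\<kappa>. (A ^\<^sub>m i *\<^sub>v u) \<bullet>c v = 0"
    and "(A ^\<^sub>m \<kappa> *\<^sub>v u) \<bullet>c v \<noteq> 0"
    and "(A ^\<^sub>m \<kappa> *\<^sub>v u) \<bullet>c v = of_real r\<^sub>\<kappa> * cis \<theta>\<^sub>\<kappa>" and "r\<^sub>\<kappa> \<ge> 0"
  shows
    "p_uv A u v \<noteq> 0 \<and> degree (p_uv A u v) = l - \<kappa> - 1 \<and>
     (\<exists>(\<omega> :: nat \<Rightarrow> complex) (\<mu> :: nat \<Rightarrow> complex \<Rightarrow> complex)
        (eig :: nat \<Rightarrow> complex \<Rightarrow> complex) (R :: real). 0 < R \<and>
        (p_uv A u v = Polynomial.smult (lead_coeff (p_uv A u v)) (\<Prod>i<l - \<kappa> - 1. [:- \<omega> i, 1:]) \<and>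
         (\<forall>\<tau>. R < norm \<tau> \<longrightarrow>
            (\<Prod>i<l - \<kappa> - 1. [:- \<mu> i \<tau>, 1:]) dvd char_poly (perturb A u v \<tau>)) \<and>
         (\<forall>i<l - \<kappa> - 1. (\<mu> i \<longlongrightarrow> \<omega> i) at_infinity)) \<and>
        ((\<forall>\<tau>. R < norm \<tau> \<longrightarrow>
            (\<Prod>j\<in>{1..\<kappa> + 1}. [:- eig j \<tau>, 1:]) dvd char_poly (perturb A u v \<tau>)) \<and>
         (\<forall>j\<in>{1..\<kappa> + 1}. \<forall>\<theta>\<in>{0..<2 * pi}.
            (\<lambda>r :: real. eig j (of_real r * cis \<theta>)
               - of_real (root (\<kappa> + 1) (r * r\<^sub>\<kappa>))
                 * cis (1 / real (\<kappa> + 1) * (\<theta> + \<theta>\<^sub>\<kappa>) + 2 * real j / real (\<kappa> + 1) * pi))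
            \<in> O[at_top](\<lambda>_. 1)) \<and>
         (\<exists>d :: nat \<Rightarrow> complex \<Rightarrow> complex. \<forall>j\<in>{1..\<kappa> + 1}.
            (\<forall>\<tau>. R < norm \<tau> \<longrightarrow>
               (eig j has_field_derivative d j \<tau>) (at \<tau> within slit_nbhd \<tau>)) \<and>
            (\<lambda>\<tau>. d j \<tau> - ((A ^\<^sub>m \<kappa> *\<^sub>v u) \<bullet>c v) / (of_nat (\<kappa> + 1) * eig j \<tau> ^ \<kappa>))
            \<in> O[at_infinity](\<lambda>\<tau>. inverse (eig j \<tau> ^ (\<kappa> + 1)))) \<and>
         (\<exists>(\<Gamma> :: real \<Rightarrow> real \<Rightarrow> complex) (C :: real). \<forall>r>R.
            closed_curve (\<Gamma> r) \<and>
            trace_of (\<Gamma> r) = (\<Union>j\<in>{1..\<kappa> + 1}. eig j ` sphere 0 r) \<and>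
            (\<forall>\<theta>\<in>{0..2 * pi}.
               norm (\<Gamma> r \<theta> - of_real ((r * r\<^sub>\<kappa>) powr (1 / real (\<kappa> + 1))) * cis \<theta>) \<le> C))) \<and>
        (\<exists>\<pi>. \<pi> permutes {1..\<kappa> + 1} \<and>
           (\<forall>r>R.
              (\<forall>j\<in>{1..\<kappa>}. ((\<lambda>\<theta>. eig (\<pi> j) (of_real r * cis \<theta>))
                 \<longlongrightarrow> eig (\<pi> (j + 1)) (of_real r)) (at_left (2 * pi))) \<and>
              ((\<lambda>\<theta>. eig (\<pi> (\<kappa> + 1)) (of_real r * cis \<theta>))
                 \<longlongrightarrow> eig (\<pi> 1) (of_real r)) (at_left (2 * pi)))) \<and>
        (\<forall>(\<nu> :: nat) (\<zeta> :: nat \<Rightarrow> complex) (k :: nat \<Rightarrow> nat)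
           (\<rho> :: nat \<Rightarrow> real) (\<phi> :: nat \<Rightarrow> real).
           inj_on \<zeta> {1..\<nu>} \<and> \<zeta> ` {1..\<nu>} = {z. poly (p_uv A u v) z = 0} \<and>
           (\<forall>j\<in>{1..\<nu>}. k j = Polynomial.order (\<zeta> j) (p_uv A u v) \<and> \<zeta> j \<notin> spectrum A \<and> \<rho> j \<ge> 0 \<and>
              ((resolvent A (\<zeta> j) ^\<^sub>m (k j + 1)) *\<^sub>v u) \<bullet>c v = of_real (\<rho> j) * cis (\<phi> j))
           \<longrightarrow>
           (\<exists>(T :: real) (\<Gamma> :: nat \<Rightarrow> real \<Rightarrow> real \<Rightarrow> complex) (C :: real). R \<le> T \<and>
              (\<forall>t>T.
                 (\<forall>j\<in>{1..\<nu> + 1}. closed_curve (\<Gamma> j t)) \<and>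
                 disjoint_family_on (\<lambda>j. trace_of (\<Gamma> j t)) {1..\<nu> + 1} \<and>
                 circle_spectrum A u v t
                   = (\<Union>j\<in>{1..\<nu> + 1}. trace_of (\<Gamma> j t)) \<union> frozen_eigenvalues A \<and>
                 trace_of (\<Gamma> (\<nu> + 1) t) = (\<Union>j\<in>{1..\<kappa> + 1}. eig j ` sphere 0 t) \<and>
                 (\<forall>\<theta>\<in>{0..2 * pi}.
                    norm (\<Gamma> (\<nu> + 1) t \<theta>
                      - of_real ((t * r\<^sub>\<kappa>) powr (1 / real (\<kappa> + 1))) * cis \<theta>) \<le> C) \<and>
                 (\<forall>j\<in>{1..\<nu>}.
                    trace_of (\<Gamma> j t)
                      = (\<Union>i\<in>{i. i < l - \<kappa> - 1 \<and> \<omega> i = \<zeta> j}. \<mu> i ` sphere 0 t) \<and>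
                    (\<forall>\<theta>\<in>{0..2 * pi}.
                       norm (\<Gamma> j t \<theta> - (\<zeta> j
                         + of_real (t powr (- 1 / real (k j)) * \<rho> j powr (- 1 / real (k j)))
                           * cis \<theta>))
                       \<le> C * t powr (- 2 / real (k j))))))))"
proof -

  \<comment> \<open>Reduction to a coprime pencil\<close>
  define m where "m = min_poly A"
  define p where "p = p_uv A u v"
  define c where "c = (A ^\<^sub>m \<kappa> *\<^sub>v u) \<bullet>c v"
  define K where "K = \<kappa> + 1"
  note A = assms(1) and u = assms(2) and v = assms(3)
  have m: "lead_coeff m = 1" using min_poly_spec[OF A] by (simp add: m_def)
  then have "m \<noteq> 0" by auto
  have c: "c \<noteq> 0" "c = of_real r\<^sub>\<kappa> * cis \<theta>\<^sub>\<kappa>" using assms(7,8) by (simp_all add: c_def)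
  have degp: "degree p = l - \<kappa> - 1" and lcp: "lead_coeff p = c"
    using degree_p_uv[OF A v u _ assms(6,7)] assms(4,5) by (simp_all add: p_def c_def)
  have "p \<noteq> 0" using lcp c(1) by auto
  have K: "0 < K" "\<kappa> = K - 1" by (simp_all add: K_def)
  \<comment> \<open>Among the \<open>K\<close> roots of \<open>c\<close> this one has argument
    \<open>\<theta>\<^sub>\<kappa> / real K\<close>, which makes the numbering of the eigenvalues
    the one in the expansion.\<close>
  define b where "b = complex_of_real (root K r\<^sub>\<kappa>) * cis (\<theta>\<^sub>\<kappa> / real K)"
  have bK: "b ^ K = c"
    using K assms(9) by (simp add: b_def c(2) power_mult_distrib Complex.DeMoivre flip: of_real_power)
  then have b: "b \<noteq> 0" using c(1) K by auto
  have norm_b: "norm b = r\<^sub>\<kappa> powr (1 / real K)"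
    using K assms(9) by (simp add: b_def norm_mult root_powr_inverse)
  obtain g m' p' where split: "m = g * m'" "p = g * p'" "lead_coeff g = 1"
    and coprime: "\<And>z. poly p' z = 0 \<Longrightarrow> poly m' z \<noteq> 0"
    using split_common_roots[OF \<open>m \<noteq> 0\<close>, of p] by blast
  have nz: "g \<noteq> 0" "m' \<noteq> 0" "p' \<noteq> 0" using split \<open>m \<noteq> 0\<close> \<open>p \<noteq> 0\<close> by auto
  have m': "lead_coeff m' = 1" and lcp': "lead_coeff p' = b ^ K"
    using m lcp split(3) unfolding split(1,2) lead_coeff_mult bK by simp_all
  have degm: "degree m = degree g + degree m'" and degp': "degree p = degree g + degree p'"
    using nz by (simp_all add: split degree_mult_eq)
  have deg': "degree p' + K = degree m'"
    using degm degp' degp assms(4,5) by (simp add: m_def K_def)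
  obtain R \<beta> \<phi> \<delta> C \<phi>0 \<delta>0 C0 where
    R: "0 < R" and br0: "branch K b \<phi>0 \<delta>0 C0"
    and br: "\<And>\<zeta>. poly p' \<zeta> = 0 \<Longrightarrow> branch (order \<zeta> p') (\<beta> \<zeta>) (\<phi> \<zeta>) (\<delta> \<zeta>) (C \<zeta>)"
    and \<beta>: "\<And>\<zeta> h. poly p' \<zeta> = 0 \<Longrightarrow> p' = [:- \<zeta>, 1:] ^ order \<zeta> p' * h \<Longrightarrow> \<beta> \<zeta> ^ order \<zeta> p' * poly m' \<zeta> = poly h \<zeta>"
    and small0: "\<And>t. R < t \<Longrightarrow> t powr (- 1 / real K) < \<delta>0"
    and small: "\<And>t \<zeta>. R < t \<Longrightarrow> poly p' \<zeta> = 0 \<Longrightarrow> t powr (- 1 / real (order \<zeta> p')) < \<delta> \<zeta>"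
    and sep0: "\<And>s \<zeta> s'. norm s < \<delta>0 \<Longrightarrow> s \<noteq> 0 \<Longrightarrow> poly p' \<zeta> = 0 \<Longrightarrow> norm s' < \<delta> \<zeta> \<Longrightarrow>
      inverse (s * \<phi>0 s) \<noteq> \<zeta> + s' * \<phi> \<zeta> s'"
    and sep: "\<And>\<zeta> s \<zeta>' s'. poly p' \<zeta> = 0 \<Longrightarrow> norm s < \<delta> \<zeta> \<Longrightarrow> poly p' \<zeta>' = 0 \<Longrightarrow> norm s' < \<delta> \<zeta>' \<Longrightarrow>
      \<zeta> + s * \<phi> \<zeta> s = \<zeta>' + s' * \<phi> \<zeta>' s' \<Longrightarrow> \<zeta> = \<zeta>'"
    and pencil: "\<And>\<tau>. R < norm \<tau> \<Longrightarrow> m' - Polynomial.smult \<tau> p' =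
      (\<Prod>j\<in>{1..K}. [:- inverse (inv_root K j \<tau> * \<phi>0 (inv_root K j \<tau>)), 1:]) *
      (\<Prod>\<zeta> | poly p' \<zeta> = 0. \<Prod>j\<in>{1..order \<zeta> p'}.
        [:- (\<zeta> + inv_root (order \<zeta> p') j \<tau> * \<phi> \<zeta> (inv_root (order \<zeta> p') j \<tau>)), 1:])"
    by (rule pencil_branches[OF m' K(1) deg' lcp' b coprime]) (assumption | rule that)+

  \<comment> \<open>Indexing of the bounded eigenvalues\<close>
  define Z where "Z = {\<zeta>. poly p' \<zeta> = 0}"
  have finZ: "finite Z" using poly_roots_finite[OF nz(3)] by (simp add: Z_def)
  define I where "I = Sigma Z (\<lambda>\<zeta>. {1..order \<zeta> p'})"
  have "finite I" using finZ by (auto simp: I_def)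
  have cardI: "card I = degree p'"
    using sum_order_eq_degree[OF nz(3)] finZ by (simp add: I_def Z_def)
  obtain e where e: "bij_betw e {..<degree p'} I"
    using ex_bij_betw_nat_finite[OF \<open>finite I\<close>] cardI by (auto simp: atLeast0LessThan)
  obtain \<gamma> where \<gamma>: "g = (\<Prod>i<degree g. [:- \<gamma> i, 1:])"
    using monic_poly_factorization[OF split(3)] by blast
  have L: "l - \<kappa> - 1 = degree p' + degree g" using degp degp' by simp

  define eig where "eig j \<tau> = inverse (inv_root K j \<tau> * \<phi>0 (inv_root K j \<tau>))" for j \<tau>
  define val where "val x \<tau> = (case x of (\<zeta>, j) \<Rightarrow>
      \<zeta> + inv_root (order \<zeta> p') j \<tau> * \<phi> \<zeta> (inv_root (order \<zeta> p') j \<tau>))" for x \<tau>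
  \<comment> \<open>Indices below \<open>degree p'\<close> enumerate, through \<open>e\<close>, a
    zero of \<open>p'\<close> together with a determination of the root; the remaining ones list the
    zeros of \<open>g\<close>, for which function and limit are the same constant.\<close>
  define \<omega> where "\<omega> i = (if i < degree p' then fst (e i) else \<gamma> (i - degree p'))" for i
  define \<mu> where "\<mu> i \<tau> = (if i < degree p' then val (e i) \<tau> else \<gamma> (i - degree p'))" for i \<tau>
  define f where "f = char_poly A div m"

  \<comment> \<open>Factorisation of the perturbed characteristic polynomial\<close>
  have prod_\<mu>: "(\<Prod>i<l - \<kappa> - 1. [:- \<mu> i \<tau>, 1:]) = (\<Prod>x\<in>I. [:- val x \<tau>, 1:]) * g" for \<tau>
  proof -
    have "(\<Prod>i<l - \<kappa> - 1. [:- \<mu> i \<tau>, 1:]) = (\<Prod>i<degree p'. [:- val (e i) \<tau>, 1:]) * (\<Prod>i<degree g. [:- \<gamma> i, 1:])"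
      unfolding L prod_lessThan_add by (simp add: \<mu>_def)
    also have "(\<Prod>i<degree p'. [:- val (e i) \<tau>, 1:]) = (\<Prod>x\<in>I. [:- val x \<tau>, 1:])"
      by (rule prod.reindex_bij_betw[OF e])
    finally show ?thesis unfolding \<gamma>[symmetric] .
  qed
  have prod_\<omega>: "p = Polynomial.smult (lead_coeff p) (\<Prod>i<l - \<kappa> - 1. [:- \<omega> i, 1:])"
  proof -
    have "(\<Prod>i<l - \<kappa> - 1. [:- \<omega> i, 1:]) = (\<Prod>i<degree p'. [:- fst (e i), 1:]) * (\<Prod>i<degree g. [:- \<gamma> i, 1:])"
      unfolding L prod_lessThan_add by (simp add: \<omega>_def)
    also have "(\<Prod>i<degree p'. [:- fst (e i), 1:]) = (\<Prod>x\<in>I. [:- fst x, 1:])"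
      by (rule prod.reindex_bij_betw[OF e])
    also have "\<dots> = (\<Prod>(\<zeta>, j)\<in>I. [:- \<zeta>, 1:])" by (intro prod.cong) auto
    also have "\<dots> = (\<Prod>\<zeta>\<in>Z. \<Prod>j\<in>{1..order \<zeta> p'}. [:- \<zeta>, 1:])"
      unfolding I_def using finZ by (intro prod.Sigma[symmetric]) auto
    also have "\<dots> = (\<Prod>\<zeta>\<in>Z. [:- \<zeta>, 1:] ^ order \<zeta> p')" by simp
    finally have "Polynomial.smult (lead_coeff p) (\<Prod>i<l - \<kappa> - 1. [:- \<omega> i, 1:])
      = Polynomial.smult (lead_coeff p) (\<Prod>\<zeta>\<in>Z. [:- \<zeta>, 1:] ^ order \<zeta> p') * g"
      unfolding \<gamma>[symmetric] by simp
    also have "Polynomial.smult (lead_coeff p) (\<Prod>\<zeta>\<in>Z. [:- \<zeta>, 1:] ^ order \<zeta> p') = p'"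
      unfolding Z_def lcp bK[symmetric] lcp'[symmetric] by (rule complex_poly_decompose)
    finally show ?thesis unfolding split(2)[symmetric] mult.commute[of p' g] by (rule sym)
  qed
  have char: "char_poly (perturb A u v \<tau>) = f * (g * ((\<Prod>j\<in>{1..K}. [:- eig j \<tau>, 1:]) * (\<Prod>x\<in>I. [:- val x \<tau>, 1:])))"
    if "R < norm \<tau>" for \<tau>
  proof -
    have "char_poly (perturb A u v \<tau>) = f * (m - Polynomial.smult \<tau> p)"
      using char_poly_perturb[OF A u v, of \<tau>] by (simp add: f_def m_def p_def)
    also have "m - Polynomial.smult \<tau> p = g * (m' - Polynomial.smult \<tau> p')"
      by (simp add: split algebra_simps)
    also have "m' - Polynomial.smult \<tau> p' = (\<Prod>j\<in>{1..K}. [:- eig j \<tau>, 1:]) * (\<Prod>x\<in>I. [:- val x \<tau>, 1:])"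
    proof -
      have val: "val (\<zeta>, j) \<tau> = \<zeta> + inv_root (order \<zeta> p') j \<tau> * \<phi> \<zeta> (inv_root (order \<zeta> p') j \<tau>)" for \<zeta> j
        by (simp add: val_def)
      have "(\<Prod>\<zeta>\<in>Z. \<Prod>j\<in>{1..order \<zeta> p'}. [:- val (\<zeta>, j) \<tau>, 1:]) = (\<Prod>(\<zeta>, j)\<in>I. [:- val (\<zeta>, j) \<tau>, 1:])"
        unfolding I_def using finZ by (intro prod.Sigma) auto
      also have "\<dots> = (\<Prod>x\<in>I. [:- val x \<tau>, 1:])" by (intro prod.cong) auto
      finally show ?thesis unfolding pencil[OF that] eig_def val Z_def by (rule arg_cong)
    qed
    finally show ?thesis .
  qed
  have dvd_\<mu>: "(\<Prod>i<l - \<kappa> - 1. [:- \<mu> i \<tau>, 1:]) dvd char_poly (perturb A u v \<tau>)" if "R < norm \<tau>" for \<tau>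
    unfolding prod_\<mu> char[OF that]
    by (rule dvdI[of _ _ "f * (\<Prod>j\<in>{1..K}. [:- eig j \<tau>, 1:])"]) (simp only: mult_ac)
  have dvd_eig: "(\<Prod>j\<in>{1..K}. [:- eig j \<tau>, 1:]) dvd char_poly (perturb A u v \<tau>)" if "R < norm \<tau>" for \<tau>
    unfolding char[OF that] by simp

  \<comment> \<open>Limits, expansions and derivatives of the eigenvalues\<close>
  have lim_\<mu>: "(\<mu> i \<longlongrightarrow> \<omega> i) at_infinity" if "i < l - \<kappa> - 1" for i
  proof (cases "i < degree p'")
    case True
    then have "e i \<in> I" using bij_betwE[OF e] by simp
    then obtain \<zeta> j where x: "e i = (\<zeta>, j)" "poly p' \<zeta> = 0" by (auto simp: I_def Z_def)
    show ?thesis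
      using branch.tendsto_branch_inv_root[OF br[OF x(2)], of \<zeta> j] True
      by (simp add: \<mu>_def[abs_def] \<omega>_def x val_def)
  qed (simp add: \<mu>_def[abs_def] \<omega>_def)
  have asymp: "(\<lambda>r::real. eig j (of_real r * cis \<theta>) - of_real (root K (r * r\<^sub>\<kappa>))
      * cis (1 / real K * (\<theta> + \<theta>\<^sub>\<kappa>) + 2 * real j / real K * pi)) \<in> O[at_top](\<lambda>_. 1)"
    if "\<theta> \<in> {0..<2 * pi}" for j \<theta>
  proof (rule bigoI[where c = C0])
    show "\<forall>\<^sub>F r in at_top. norm (eig j (of_real r * cis \<theta>) - of_real (root K (r * r\<^sub>\<kappa>))
      * cis (1 / real K * (\<theta> + \<theta>\<^sub>\<kappa>) + 2 * real j / real K * pi)) \<le> C0 * norm (1::complex)"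
      using eventually_gt_at_top[of R]
    proof eventually_elim
      case (elim r)
      then show ?case
        using branch.inverse_branch_asymp[OF br0 b_def that _ small0[OF elim], of j] R by (simp add: eig_def)
    qed
  qed
  have deriv: "(eig j has_field_derivative branch.eig_deriv K \<phi>0 (inv_root K j \<tau>)) (at \<tau> within slit_nbhd \<tau>)"
    if "R < norm \<tau>" for j \<tau>
  proof -
    have "\<tau> \<noteq> 0" using that R by auto
    from branch.has_field_derivative_eig[OF br0 this small0[OF that]] show ?thesis
      by (simp add: eig_def[abs_def])
  qed
  have deriv_asymp: "(\<lambda>\<tau>. branch.eig_deriv K \<phi>0 (inv_root K j \<tau>) - c / (of_nat K * eig j \<tau> ^ \<kappa>))
      \<in> O[at_infinity](\<lambda>\<tau>. inverse (eig j \<tau> ^ K))" for j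
  proof (rule bigoI[where c = "C0 * (norm b + C0 * \<delta>0) ^ K"])
    show "\<forall>\<^sub>F \<tau> in at_infinity. norm (branch.eig_deriv K \<phi>0 (inv_root K j \<tau>) - c / (of_nat K * eig j \<tau> ^ \<kappa>))
      \<le> C0 * (norm b + C0 * \<delta>0) ^ K * norm (inverse (eig j \<tau> ^ K))"
      unfolding eventually_at_infinity
    proof (intro exI[of _ "R + 1"] allI impI)
      fix \<tau> :: complex assume "R + 1 \<le> norm \<tau>"
      then have \<tau>: "R < norm \<tau>" "\<tau> \<noteq> 0" using R by auto
      have "norm (inv_root K j \<tau>) < \<delta>0" "inv_root K j \<tau> \<noteq> 0"
        using norm_inv_root[OF \<tau>(2)] small0[OF \<tau>(1)] by (auto simp: inv_root_def)
      from branch.norm_eig_deriv_diff[OF br0 this]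
      show "norm (branch.eig_deriv K \<phi>0 (inv_root K j \<tau>) - c / (of_nat K * eig j \<tau> ^ \<kappa>))
        \<le> C0 * (norm b + C0 * \<delta>0) ^ K * norm (inverse (eig j \<tau> ^ K))"
        by (simp only: eig_def bK K(2))
    qed
  qed

  \<comment> \<open>The curve of unbounded eigenvalues and its monodromy\<close>
  have trace_eig: "trace_of (branch.curve_inf K b \<phi>0 r) = (\<Union>j\<in>{1..K}. eig j ` sphere 0 r)" if "R < r" for r
    unfolding branch.trace_of_curve_inf[OF br0] eig_def
    using inv_root_image_sphere[of r K "\<lambda>s. inverse (s * \<phi>0 s)"] that R K(1) by simp
  have curve_eig: "closed_curve (branch.curve_inf K b \<phi>0 r)" if "R < r" for r
    using branch.curve_inf_closed[OF br0 small0[OF that]] that R by simp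
  have curve_eig_asymp: "norm (branch.curve_inf K b \<phi>0 r \<theta> - of_real ((r * r\<^sub>\<kappa>) powr (1 / real K)) * cis \<theta>) \<le> C0"
    if "R < r" for r \<theta>
  proof -
    have "r powr (1 / real K) * norm b = (r * r\<^sub>\<kappa>) powr (1 / real K)"
      using that R assms(9) by (simp add: norm_b powr_mult)
    then show ?thesis
      using branch.curve_inf_asymp[OF br0 small0[OF that], of \<theta>] that R by simp
  qed
  have cycle: "((\<lambda>\<theta>. eig j (of_real r * cis \<theta>)) \<longlongrightarrow> eig (Suc j) (of_real r)) (at_left (2 * pi))" if "R < r" for r j
    unfolding eig_def using that R by (intro branch.tendsto_inverse_branch_2pi[OF br0] small0) auto
  have eig_period: "eig (Suc K) \<tau> = eig 1 \<tau>" for \<tau>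
    using inv_root_period[OF K(1), of 1] by (simp add: eig_def)

  \<comment> \<open>Disjoint curves around the zeros of the numerator polynomial\<close>
  have finite_curves: "\<exists>(T :: real) (\<Gamma> :: nat \<Rightarrow> real \<Rightarrow> real \<Rightarrow> complex) (C :: real). R \<le> T \<and>
      (\<forall>t>T.
         (\<forall>j\<in>{1..\<nu> + 1}. closed_curve (\<Gamma> j t)) \<and>
         disjoint_family_on (\<lambda>j. trace_of (\<Gamma> j t)) {1..\<nu> + 1} \<and>
         circle_spectrum A u v t = (\<Union>j\<in>{1..\<nu> + 1}. trace_of (\<Gamma> j t)) \<union> frozen_eigenvalues A \<and>
         trace_of (\<Gamma> (\<nu> + 1) t) = (\<Union>j\<in>{1..K}. eig j ` sphere 0 t) \<and>
         (\<forall>\<theta>\<in>{0..2 * pi}. norm (\<Gamma> (\<nu> + 1) t \<theta> - of_real ((t * r\<^sub>\<kappa>) powr (1 / real K)) * cis \<theta>) \<le> C) \<and>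
         (\<forall>j\<in>{1..\<nu>}.
            trace_of (\<Gamma> j t) = (\<Union>i\<in>{i. i < l - \<kappa> - 1 \<and> \<omega> i = \<zeta> j}. \<mu> i ` sphere 0 t) \<and>
            (\<forall>\<theta>\<in>{0..2 * pi}.
               norm (\<Gamma> j t \<theta> - (\<zeta> j + of_real (t powr (- 1 / real (k j)) * \<rho> j powr (- 1 / real (k j))) * cis \<theta>))
               \<le> C * t powr (- 2 / real (k j)))))"
    if inj: "inj_on \<zeta> {1..\<nu>}" and img: "\<zeta> ` {1..\<nu>} = {z. poly p z = 0}"
      and data: "\<forall>j\<in>{1..\<nu>}. k j = Polynomial.order (\<zeta> j) p \<and> \<zeta> j \<notin> spectrum A \<and> \<rho> j \<ge> 0 \<and>
        ((resolvent A (\<zeta> j) ^\<^sub>m (k j + 1)) *\<^sub>v u) \<bullet>c v = of_real (\<rho> j) * cis (\<psi> j)"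
    for \<nu> :: nat and \<zeta> :: "nat \<Rightarrow> complex" and k :: "nat \<Rightarrow> nat" and \<rho> \<psi> :: "nat \<Rightarrow> real"
  proof -
    \<comment> \<open>A zero of \<open>g\<close> would be a zero of \<open>p\<close>, hence off the
      spectrum by assumption, and also one of the minimal polynomial, hence in it. So
      \<open>g\<close> is constant, and \<open>p\<close> and \<open>p'\<close> have the same zeros
      with the same orders.\<close>
    have g_no_root: "poly g z \<noteq> 0" for z
    proof
      assume g0: "poly g z = 0"
      then have "z \<in> \<zeta> ` {1..\<nu>}" unfolding img by (simp add: split(2))
      then have "z \<notin> spectrum A" using data by auto
      moreover have "z \<in> spectrum A"
        using g0 min_poly_root_in_spectrum[OF A, of z] split(1) by (simp add: m_def)
      ultimately show False by simp
    qed
    then have deg_g: "degree g = 0"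
      using Fundamental_Theorem_Algebra.fundamental_theorem_of_algebra[of g] by (auto simp flip: constant_degree)
    have root_p': "poly p' (\<zeta> j) = 0" if "j \<in> {1..\<nu>}" for j
    proof -
      have "poly p (\<zeta> j) = 0" using img that by auto
      then show ?thesis using g_no_root by (simp add: split(2))
    qed
    have Z_eq: "Z = \<zeta> ` {1..\<nu>}" unfolding img Z_def using g_no_root by (auto simp: split(2))
    have k_eq: "k j = order (\<zeta> j) p'" if "j \<in> {1..\<nu>}" for j
      using data that \<open>p \<noteq> 0\<close> g_no_root by (simp add: split(2) order_mult order_0I)
    \<comment> \<open>Two descriptions of the cofactor at the zero are compared: iterated division
      by the resolvent gives (-1)^k m rho e^(i psi), the branch gives beta^k m. Taking moduli leaves
      |beta|^k = rho; sign and phase only rotate the parametrisation.\<close>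
    have norm_\<beta>: "inverse (norm (\<beta> (\<zeta> j))) = \<rho> j powr (- 1 / real (k j))" if j: "j \<in> {1..\<nu>}" for j
    proof -
      let ?k = "k j"
      have k: "0 < ?k" using branch.k_pos[OF br[OF root_p'[OF j]]] k_eq[OF j] by simp
      have spec: "\<zeta> j \<notin> spectrum A" and kp: "?k = order (\<zeta> j) p" and \<rho>0: "0 \<le> \<rho> j"
        and res: "(resolvent A (\<zeta> j) ^\<^sub>m (?k + 1) *\<^sub>v u) \<bullet>c v = of_real (\<rho> j) * cis (\<psi> j)"
        using data j by blast+
      have "[:- \<zeta> j, 1:] ^ ?k dvd p_uv A u v" unfolding kp p_def by (rule order_1)
      from p_uv_factor_root[OF A v spec u this] obtain h where h: "p = [:- \<zeta> j, 1:] ^ ?k * h"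
        "poly h (\<zeta> j) = (-1) ^ ?k * poly m (\<zeta> j) * (of_real (\<rho> j) * cis (\<psi> j))"
        unfolding res p_def[symmetric] m_def[symmetric] by blast
      obtain h' where h': "p' = [:- \<zeta> j, 1:] ^ ?k * h'"
        unfolding k_eq[OF j] by (rule dvdE[OF order_1])
      have "[:- \<zeta> j, 1:] ^ ?k * h = [:- \<zeta> j, 1:] ^ ?k * (g * h')"
        using h(1) h' split(2) by (metis mult.left_commute)
      then have "h = g * h'" by simp
      moreover have "\<beta> (\<zeta> j) ^ ?k * poly m' (\<zeta> j) = poly h' (\<zeta> j)"
        using \<beta>[OF root_p'[OF j] h'[unfolded k_eq[OF j]]] unfolding k_eq[OF j] .
      ultimately have "\<beta> (\<zeta> j) ^ ?k * poly m (\<zeta> j) = poly m (\<zeta> j) * ((-1) ^ ?k * (of_real (\<rho> j) * cis (\<psi> j)))"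
        using h(2) unfolding split(1) by (simp add: mult_ac)
      moreover have "poly m (\<zeta> j) \<noteq> 0" using min_poly_root_in_spectrum[OF A] spec by (auto simp: m_def)
      ultimately have "\<beta> (\<zeta> j) ^ ?k = (-1) ^ ?k * (of_real (\<rho> j) * cis (\<psi> j))"
        by (metis mult.commute mult_cancel_left)
      from arg_cong[OF this, of norm] have "norm (\<beta> (\<zeta> j)) ^ ?k = \<rho> j"
        using \<rho>0 by (simp add: norm_mult norm_power)
      then have "norm (\<beta> (\<zeta> j)) = root ?k (\<rho> j)"
        using k by (metis norm_ge_zero real_root_power_cancel)
      then show ?thesis using k \<rho>0 by (simp add: root_powr_inverse powr_minus)
    qed
    define \<Gamma> where "\<Gamma> j t = (if j = \<nu> + 1 then branch.curve_inf K b \<phi>0 t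
      else (\<lambda>\<theta>. \<zeta> j + branch.curve (k j) (\<beta> (\<zeta> j)) (\<phi> (\<zeta> j)) t \<theta>))" for j t
    \<comment> \<open>A single constant for all curves: the zeros form a finite set and all summands
      are nonnegative.\<close>
    define D where "D = C0 + (\<Sum>z\<in>Z. C z)"
    have C_nonneg: "0 \<le> C z" if "z \<in> Z" for z
      using branch.C_nonneg[OF br] that by (simp add: Z_def)
    have C0_nonneg: "0 \<le> C0" by (rule branch.C_nonneg[OF br0])
    have D: "C0 \<le> D" "\<And>z. z \<in> Z \<Longrightarrow> C z \<le> D"
      using sum_nonneg[of Z C] member_le_sum[of _ Z C] C_nonneg C0_nonneg finZ
      by (auto simp: D_def add_increasing)
    have bj: "branch (k j) (\<beta> (\<zeta> j)) (\<phi> (\<zeta> j)) (\<delta> (\<zeta> j)) (C (\<zeta> j))" if "j \<in> {1..\<nu>}" for j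
      using br[OF root_p'[OF that]] k_eq[OF that] by simp
    have smallj: "t powr (- 1 / real (k j)) < \<delta> (\<zeta> j)" if "R < t" "j \<in> {1..\<nu>}" for t j
      using small[OF that(1) root_p'[OF that(2)]] k_eq[OF that(2)] by simp
    have trace_j: "trace_of (\<Gamma> j t) = (\<lambda>s. \<zeta> j + s * \<phi> (\<zeta> j) s) ` sphere 0 (t powr (- 1 / real (k j)))"
      if "j \<in> {1..\<nu>}" for j t
      using that branch.trace_of_curve[OF bj[OF that]] by (simp add: \<Gamma>_def)
    have trace_inf: "trace_of (\<Gamma> (\<nu> + 1) t) = (\<lambda>s. inverse (s * \<phi>0 s)) ` sphere 0 (t powr (- 1 / real K))" for t
      by (simp add: \<Gamma>_def branch.trace_of_curve_inf[OF br0])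
    have trace_j': "trace_of (\<Gamma> j t) = (\<Union>q\<in>{1..k j}. val (\<zeta> j, q) ` sphere 0 t)" if "j \<in> {1..\<nu>}" "R < t" for j t
      unfolding trace_j[OF that(1)] val_def prod.case
      using inv_root_image_sphere[of t "k j" "\<lambda>s. \<zeta> j + s * \<phi> (\<zeta> j) s"] that(2) R
        branch.k_pos[OF bj[OF that(1)]] k_eq[OF that(1)] by simp
    have closed: "closed_curve (\<Gamma> j t)" if "j \<in> {1..\<nu> + 1}" "R < t" for j t
    proof (cases "j = \<nu> + 1")
      case True
      then show ?thesis using curve_eig[OF that(2)] by (simp add: \<Gamma>_def)
    next
      case False
      then have j: "j \<in> {1..\<nu>}" using that by auto
      show ?thesis
        using branch.curve_closed[OF bj[OF j] smallj[OF that(2) j]] False by (simp add: \<Gamma>_def)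
    qed
    have disj0: "trace_of (\<Gamma> j t) \<inter> trace_of (\<Gamma> (\<nu> + 1) t) = {}" if "j \<in> {1..\<nu>}" "R < t" for j t
    proof -
      have "inverse (s * \<phi>0 s) \<noteq> \<zeta> j + s' * \<phi> (\<zeta> j) s'"
        if s: "norm s = t powr (- 1 / real K)" "norm s' = t powr (- 1 / real (k j))" for s s'
      proof (rule sep0[OF _ _ root_p'[OF \<open>j \<in> {1..\<nu>}\<close>]])
        show "norm s < \<delta>0" using small0[OF \<open>R < t\<close>] s by simp
        have "0 < norm s" using s(1) \<open>R < t\<close> R by simp
        then show "s \<noteq> 0" by auto
        show "norm s' < \<delta> (\<zeta> j)" using smallj[OF \<open>R < t\<close> \<open>j \<in> {1..\<nu>}\<close>] s by simp
      qed
      then show ?thesis unfolding trace_j[OF that(1)] trace_inf by force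
    qed
    have disj1: "trace_of (\<Gamma> i t) \<inter> trace_of (\<Gamma> j t) = {}" if "i \<in> {1..\<nu>}" "j \<in> {1..\<nu>}" "i \<noteq> j" "R < t" for i j t
    proof -
      have "\<zeta> i \<noteq> \<zeta> j" using inj_onD[OF inj] that by blast
      then have "\<zeta> i + s * \<phi> (\<zeta> i) s \<noteq> \<zeta> j + s' * \<phi> (\<zeta> j) s'"
        if "norm s = t powr (- 1 / real (k i))" "norm s' = t powr (- 1 / real (k j))" for s s'
        using sep[OF root_p'[OF \<open>i \<in> {1..\<nu>}\<close>] _ root_p'[OF \<open>j \<in> {1..\<nu>}\<close>], of s s']
          smallj[OF \<open>R < t\<close>] \<open>i \<in> {1..\<nu>}\<close> \<open>j \<in> {1..\<nu>}\<close> that by auto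
      then show ?thesis unfolding trace_j[OF that(1)] trace_j[OF that(2)] by force
    qed
    have disjoint: "disjoint_family_on (\<lambda>j. trace_of (\<Gamma> j t)) {1..\<nu> + 1}" if "R < t" for t
      unfolding disjoint_family_on_def
    proof (intro ballI impI)
      fix i j assume ij: "i \<in> {1..\<nu> + 1}" "j \<in> {1..\<nu> + 1}" "i \<noteq> j"
      consider "i \<in> {1..\<nu>}" "j \<in> {1..\<nu>}" | "i \<in> {1..\<nu>}" "j = \<nu> + 1" | "i = \<nu> + 1" "j \<in> {1..\<nu>}"
        using ij by fastforce
      then show "trace_of (\<Gamma> i t) \<inter> trace_of (\<Gamma> j t) = {}"
        using disj0[OF _ that] disj1[OF _ _ ij(3) that] by cases (blast, blast, blast)
    qed
    have trace_\<mu>: "trace_of (\<Gamma> j t) = (\<Union>i\<in>{i. i < l - \<kappa> - 1 \<and> \<omega> i = \<zeta> j}. \<mu> i ` sphere 0 t)"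
      if j: "j \<in> {1..\<nu>}" and t: "R < t" for j t
    proof -
      let ?S = "{i. i < l - \<kappa> - 1 \<and> \<omega> i = \<zeta> j}"
      \<comment> \<open>As \<open>g\<close> is constant there are no constant members, so the
        indices with limit \<open>\<zeta> j\<close> correspond under \<open>e\<close> to the pairs
        of this zero and its \<open>k j\<close> determinations.\<close>
      have S: "?S = {i \<in> {..<degree p'}. fst (e i) = \<zeta> j}" using L deg_g by (auto simp: \<omega>_def)
      have "e ` ?S = {x \<in> I. fst x = \<zeta> j}"
        unfolding S using bij_betw_imp_surj_on[OF e] by auto
      also have "\<dots> = (\<lambda>q. (\<zeta> j, q)) ` {1..k j}"
        using root_p'[OF j] k_eq[OF j] by (auto simp: I_def Z_def)
      finally have eS: "e ` ?S = (\<lambda>q. (\<zeta> j, q)) ` {1..k j}" .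
      have "(\<Union>i\<in>?S. \<mu> i ` sphere 0 t) = (\<Union>i\<in>?S. val (e i) ` sphere 0 t)"
        unfolding S by (intro SUP_cong refl) (simp add: \<mu>_def[abs_def])
      also have "\<dots> = (\<Union>x\<in>e ` ?S. val x ` sphere 0 t)" by simp
      also have "\<dots> = trace_of (\<Gamma> j t)" unfolding eS trace_j'[OF j t] by simp
      finally show ?thesis ..
    qed
    have asymp_j: "norm (\<Gamma> j t \<theta> - (\<zeta> j + of_real (t powr (- 1 / real (k j)) * \<rho> j powr (- 1 / real (k j))) * cis \<theta>))
        \<le> D * t powr (- 2 / real (k j))" if j: "j \<in> {1..\<nu>}" and t: "R < t" for j t \<theta>
    proof -
      have "norm (\<Gamma> j t \<theta> - (\<zeta> j + of_real (t powr (- 1 / real (k j)) * \<rho> j powr (- 1 / real (k j))) * cis \<theta>))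
        \<le> C (\<zeta> j) * t powr (- 2 / real (k j))"
        using branch.curve_asymp[OF bj[OF j] smallj[OF t j], of \<theta>] j
        unfolding norm_\<beta>[OF j] by (simp add: \<Gamma>_def)
      also have "\<dots> \<le> D * t powr (- 2 / real (k j))"
        using D(2)[of "\<zeta> j"] root_p'[OF j] by (intro mult_right_mono) (auto simp: Z_def)
      finally show ?thesis .
    qed
    have spectrum_t: "circle_spectrum A u v t = (\<Union>j\<in>{1..\<nu> + 1}. trace_of (\<Gamma> j t)) \<union> frozen_eigenvalues A"
      if t: "R < t" for t
    proof -
      have t0: "0 < t" using t R by simp
      have sphere: "(\<lambda>\<theta>. of_real t * cis \<theta>) ` {0..<2 * pi} = sphere (0::complex) t"
      proof (intro equalityI subsetI)
        fix \<tau> :: complex assume "\<tau> \<in> sphere 0 t"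
        then have "\<tau> = of_real t * cis (Arg2pi \<tau>)" using Arg2pi_eq[of \<tau>] by (simp add: cis_conv_exp)
        moreover have "Arg2pi \<tau> \<in> {0..<2 * pi}" using Arg2pi[of \<tau>] by simp
        ultimately show "\<tau> \<in> (\<lambda>\<theta>. of_real t * cis \<theta>) ` {0..<2 * pi}" by blast
      qed (use t0 in \<open>auto simp: norm_mult\<close>)
      have spec: "spectrum (perturb A u v \<tau>) = frozen_eigenvalues A \<union> (\<Union>j\<in>{1..K}. {eig j \<tau>}) \<union> (\<Union>x\<in>I. {val x \<tau>})"
        if "\<tau> \<in> sphere 0 t" for \<tau>
      proof -
        have P: "perturb A u v \<tau> \<in> carrier_mat n n" using A u v by (auto simp: perturb_def outer_def)
        have "R < norm \<tau>" using that t by simp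
        have r1: "poly (\<Prod>j\<in>{1..K}. [:- eig j \<tau>, 1:]) z = 0 \<longleftrightarrow> z \<in> (\<Union>j\<in>{1..K}. {eig j \<tau>})" for z
          by (simp add: poly_prod del: UN_singleton)
        have r2: "poly (\<Prod>x\<in>I. [:- val x \<tau>, 1:]) z = 0 \<longleftrightarrow> z \<in> (\<Union>x\<in>I. {val x \<tau>})" for z
          using \<open>finite I\<close> by (simp add: poly_prod del: UN_singleton)
        show ?thesis
          unfolding set_eq_iff mem_spectrum_iff[OF P] char[OF \<open>R < norm \<tau>\<close>] poly_mult mult_eq_0_iff r1 r2 Un_iff
          using g_no_root by (simp add: frozen_eigenvalues_def f_def m_def del: UN_iff UN_singleton)
      qed
      have "circle_spectrum A u v t = (\<Union>\<tau>\<in>sphere 0 t. spectrum (perturb A u v \<tau>))"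
        unfolding circle_spectrum_def sphere[symmetric] by simp
      also have "\<dots> = (\<Union>\<tau>\<in>sphere 0 t. frozen_eigenvalues A \<union> (\<Union>j\<in>{1..K}. {eig j \<tau>}) \<union> (\<Union>x\<in>I. {val x \<tau>}))"
        using spec by simp
      also have "\<dots> = frozen_eigenvalues A \<union> (\<Union>j\<in>{1..K}. eig j ` sphere 0 t) \<union> (\<Union>x\<in>I. val x ` sphere 0 t)"
      proof -
        \<comment> \<open>The circle is nonempty, so the parameter-free set survives the union over
          it.\<close>
        have "of_real t \<in> sphere (0::complex) t" using t0 by simp
        then show ?thesis by blast
      qed
      also have "(\<Union>j\<in>{1..K}. eig j ` sphere 0 t) = trace_of (\<Gamma> (\<nu> + 1) t)"
        using trace_eig[OF t] by (simp add: \<Gamma>_def)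
      also have "(\<Union>x\<in>I. val x ` sphere 0 t) = (\<Union>j\<in>{1..\<nu>}. trace_of (\<Gamma> j t))"
      proof -
        have "(\<Union>x\<in>I. val x ` sphere 0 t) = (\<Union>z\<in>Z. \<Union>q\<in>{1..order z p'}. val (z, q) ` sphere 0 t)"
          unfolding I_def by blast
        also have "\<dots> = (\<Union>j\<in>{1..\<nu>}. \<Union>q\<in>{1..order (\<zeta> j) p'}. val (\<zeta> j, q) ` sphere 0 t)"
          unfolding Z_eq by simp
        also have "\<dots> = (\<Union>j\<in>{1..\<nu>}. trace_of (\<Gamma> j t))"
          by (intro SUP_cong refl) (simp add: trace_j'[OF _ t] k_eq)
        finally show ?thesis .
      qed
      also have "frozen_eigenvalues A \<union> trace_of (\<Gamma> (\<nu> + 1) t) \<union> (\<Union>j\<in>{1..\<nu>}. trace_of (\<Gamma> j t))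
        = (\<Union>j\<in>{1..\<nu> + 1}. trace_of (\<Gamma> j t)) \<union> frozen_eigenvalues A"
        by (simp add: atLeastAtMostSuc_conv Un_ac)
      finally show ?thesis .
    qed
    have asymp_inf: "norm (\<Gamma> (\<nu> + 1) t \<theta> - of_real ((t * r\<^sub>\<kappa>) powr (1 / real K)) * cis \<theta>) \<le> D" if "R < t" for t \<theta>
      using order_trans[OF curve_eig_asymp[OF that] D(1)] by (simp add: \<Gamma>_def)
    have trace_inf': "trace_of (\<Gamma> (\<nu> + 1) t) = (\<Union>j\<in>{1..K}. eig j ` sphere 0 t)" if "R < t" for t
      using trace_eig[OF that] by (simp add: \<Gamma>_def)
    \<comment> \<open>\<open>R\<close> itself serves as the threshold \<open>T\<close>, since
      smallness and separation of all branches already hold beyond it.\<close>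
    show ?thesis
      by (intro exI[of _ R] exI[of _ \<Gamma>] exI[of _ D] conjI allI impI ballI order_refl
          closed disjoint spectrum_t trace_inf' asymp_inf trace_\<mu> asymp_j)
  qed

  \<comment> \<open>Assembly of the conclusions\<close>
  have part_ii: "p = Polynomial.smult (lead_coeff p) (\<Prod>i<l - \<kappa> - 1. [:- \<omega> i, 1:]) \<and>
         (\<forall>\<tau>. R < norm \<tau> \<longrightarrow>
            (\<Prod>i<l - \<kappa> - 1. [:- \<mu> i \<tau>, 1:]) dvd char_poly (perturb A u v \<tau>)) \<and>
         (\<forall>i<l - \<kappa> - 1. (\<mu> i \<longlongrightarrow> \<omega> i) at_infinity)"
    using prod_\<omega> dvd_\<mu> lim_\<mu> by blast
  have part_iii: "(\<forall>\<tau>. R < norm \<tau> \<longrightarrow> (\<Prod>j\<in>{1..K}. [:- eig j \<tau>, 1:]) dvd char_poly (perturb A u v \<tau>)) \<and>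
         (\<forall>j\<in>{1..K}. \<forall>\<theta>\<in>{0..<2 * pi}.
            (\<lambda>r :: real. eig j (of_real r * cis \<theta>)
               - of_real (root K (r * r\<^sub>\<kappa>))
                 * cis (1 / real K * (\<theta> + \<theta>\<^sub>\<kappa>) + 2 * real j / real K * pi))
            \<in> O[at_top](\<lambda>_. 1)) \<and>
         (\<exists>d :: nat \<Rightarrow> complex \<Rightarrow> complex. \<forall>j\<in>{1..K}.
            (\<forall>\<tau>. R < norm \<tau> \<longrightarrow>
               (eig j has_field_derivative d j \<tau>) (at \<tau> within slit_nbhd \<tau>)) \<and>
            (\<lambda>\<tau>. d j \<tau> - c / (of_nat K * eig j \<tau> ^ \<kappa>))
            \<in> O[at_infinity](\<lambda>\<tau>. inverse (eig j \<tau> ^ K))) \<and>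
         (\<exists>(\<Gamma> :: real \<Rightarrow> real \<Rightarrow> complex) (C :: real). \<forall>r>R.
            closed_curve (\<Gamma> r) \<and>
            trace_of (\<Gamma> r) = (\<Union>j\<in>{1..K}. eig j ` sphere 0 r) \<and>
            (\<forall>\<theta>\<in>{0..2 * pi}.
               norm (\<Gamma> r \<theta> - of_real ((r * r\<^sub>\<kappa>) powr (1 / real K)) * cis \<theta>) \<le> C))"
    by (intro conjI allI impI ballI dvd_eig asymp
        exI[of _ "\<lambda>j \<tau>. branch.eig_deriv K \<phi>0 (inv_root K j \<tau>)"] deriv deriv_asymp
        exI[of _ "branch.curve_inf K b \<phi>0"] exI[of _ C0] curve_eig trace_eig curve_eig_asymp)
  have part_iv: "\<exists>\<pi>. \<pi> permutes {1..K} \<and>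
           (\<forall>r>R.
              (\<forall>j\<in>{1..\<kappa>}. ((\<lambda>\<theta>. eig (\<pi> j) (of_real r * cis \<theta>))
                 \<longlongrightarrow> eig (\<pi> (j + 1)) (of_real r)) (at_left (2 * pi))) \<and>
              ((\<lambda>\<theta>. eig (\<pi> K) (of_real r * cis \<theta>))
                 \<longlongrightarrow> eig (\<pi> 1) (of_real r)) (at_left (2 * pi)))"
  \<comment> \<open>The numbering by determinations is already cyclic; after the last index
    \<open>eig_period\<close> leads back to the first.\<close>
  proof (intro exI[of _ id] conjI allI impI ballI)
    show "id permutes {1..K}" by (rule permutes_id)
    fix r assume r: "R < r"
    show "((\<lambda>\<theta>. eig (id K) (of_real r * cis \<theta>)) \<longlongrightarrow> eig (id 1) (of_real r)) (at_left (2 * pi))"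
      using cycle[OF r, of K] unfolding eig_period id_apply .
    show "((\<lambda>\<theta>. eig (id j) (of_real r * cis \<theta>)) \<longlongrightarrow> eig (id (j + 1)) (of_real r)) (at_left (2 * pi))" for j
      using cycle[OF r, of j] unfolding id_apply Suc_eq_plus1 .
  qed
  show ?thesis
    unfolding p_def[symmetric] c_def[symmetric] K_def[symmetric]
    by (rule conjI, rule \<open>p \<noteq> 0\<close>, rule conjI, rule degp,
        rule exI[of _ \<omega>], rule exI[of _ \<mu>], rule exI[of _ eig], rule exI[of _ R],
        rule conjI, rule R, rule conjI, rule part_ii, rule conjI, rule part_iii, rule conjI, rule part_iv,
        intro allI impI, elim conjE, rule finite_curves)
qed

end
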